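(* Let $f:\mathbb{R}^n\times\mathbb{R}^m\to\mathbb{R}$ satisfy the standing assumptions (1)-(4) of the context, with constants $\kappa,L_1,L_H,L_2$ as defined there. Let $0<\varepsilon\leqslant\min\{L_2/2,\,1\}$ and run the HSDA algorithm described in the context with parameters $$\alpha=\sqrt{L_2\varepsilon},\qquad \varepsilon_1=\frac{\varepsilon}{12},\qquad \varepsilon_2=\frac{\sqrt{L_2\varepsilon}}{12},\qquad \Lambda=\sqrt{\varepsilon/L_2},\qquad \omega\in(0,1/2).$$ Let $$\widetilde T(\varepsilon):=\min\Bigl\{t\geqslant 1 : |v_t|>\sqrt{1/(1+\Lambda^2)}\Bigr\}.$$ Then $\widetilde T(\varepsilon)$ is finite and the iterate $x_{\widetilde T(\varepsilon)+1}$ satisfies $$\|\nabla\mathcal{F}(x_{\widetilde T(\varepsilon)+1})\|\leqslant\Bigl(\frac{\sqrt2\,L_1}{L_2}+\frac{17}{6}\Bigr)\varepsilon,$$ $$\nabla^2\mathcal{F}(x_{\widetilde T(\varepsilon)+1})\succcurlyeq-\Bigl[\frac{\sqrt2\,L_1}{\sqrt{L_2}}+\frac{13}{6}\sqrt{L_2}+\frac{L_H(1+\kappa)}{\sqrt{L_2}}\Bigr]\sqrt{\varepsilon}\,I.$$ Furthermore, with $c_1:=\frac{\sqrt2 L_1}{L_2}+\frac{17}{6}$, $c_2:=\frac{\sqrt2 L_1}{\sqrt{L_2}}+\frac{13}{6}\sqrt{L_2}+\frac{L_H(1+\kappa)}{\sqrt{L_2}}$ and $$T(\varepsilon):=\min\Bigl\{t\geqslant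 1 : \|\nabla\mathcal{F}(x_{t+1})\|\leqslant c_1\varepsilon\ \text{ and }\ \nabla^2\mathcal{F}(x_{t+1})\succcurlyeq-c_2\sqrt{\varepsilon}\,I\Bigr\},$$ one has $$T(\varepsilon)\leqslant\widetilde T(\varepsilon)\leqslant 1+\frac{24\sqrt{L_2}}{5}\bigl(\mathcal{F}(x_1)-\mathcal{F}_{\inf}\bigr)\varepsilon^{-3/2}.$$
   Context: Norms: $\|\cdot\|$ is the Euclidean norm for vectors and the induced operator norm for matrices. $\operatorname{sgn}(a)=-1$ if $a<0$ and $\operatorname{sgn}(a)=1$ if $a\geqslant0$. Standing assumptions on $f:\mathbb{R}^n\times\mathbb{R}^m\to\mathbb{R}$ (twice differentiable): (1) for each $x$, $f(x,\cdot)$ is $\mu$-strongly concave, $\mu>0$; (2) $\nabla f$ is $\ell_1$-Lipschitz in the joint variable $(x,y)$; (3) the Hessian blocks $\nabla^2_{xx}f,\nabla^2_{xy}f,\nabla^2_{yx}f,\nabla^2_{yy}f$ are $\ell_2$-Lipschitz continuous in $(x,y)$; (4) $\mathcal{F}(x):=\max_{y\in\mathbb{R}^m}f(x,y)$ is bounded below, with finite lower bound $\mathcal{F}_{\inf}$. Constants: $\kappa:=\ell_1/\mu$, $L_1:=(\kappa+1)\ell_1$, $L_H:=\ell_2(1+\kappa)^2$, $L_2:=\ell_2(1+\kappa)^3$. Let $y^*(x):=\arg\max_y f(x,y)$ and $H(x,y):=[\nabla^2_{xx}f-\nabla^2_{xy}f(\nabla^2_{yy}f)^{-1}\nabla^2_{yx}f](x,y)$.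 Under the assumptions, $\mathcal{F}$ is twice differentiable with $\nabla\mathcal{F}(x)=\nabla_xf(x,y^*(x))$ and $\nabla^2\mathcal{F}(x)=H(x,y^*(x))$. HSDA algorithm. Inputs: $x_1\in\mathbb{R}^n$, $y_0\in\mathbb{R}^m$, $\omega\in(0,1/2)$, $\alpha>0$, $\Lambda>0$, tolerances $\varepsilon_1,\varepsilon_2>0$, inner step sizes $\eta_1=1/\ell_1$, $\eta_2=(\sqrt\kappa-1)/(\sqrt\kappa+1)$, and inner iteration counts $N_t\geqslant1$. For $t=1,2,\dots$: (a) Set $y_0^t=\tilde y_0^t=y_{t-1}$; for $i=0,\dots,N_t-1$ set $y_{i+1}^t=\tilde y_i^t+\eta_1\nabla_yf(x_t,\tilde y_i^t)$ and $\tilde y_{i+1}^t=y_{i+1}^t+\eta_2(y_{i+1}^t-y_i^t)$; put $y_t=y_{N_t}^t$. (b) Put $g_t=\nabla_xf(x_t,y_t)$, $H_t=H(x_t,y_t)$, and let $[u_t;v_t]$ ($u_t\in\mathbb{R}^n$, $v_t\in\mathbb{R}$) be a minimizer of $\begin{bmatrix} u \\ v \end{bmatrix}^\top \begin{bmatrix} H_t & g_t \\ g_t^\top & -\alpha \end{bmatrix} \begin{bmatrix} u \\ v \end{bmatrix}$ over $\|[u;v]\|\leqslant1$. (c) Put $s_t=u_t/v_t$ if $|v_t|\geqslant\omega$, and $s_t=\operatorname{sgn}(-g_t^\top u_t)\,u_t$ if $|v_t|<\omega$. (d) If $|v_t|>\sqrt{1/(1+\Lambda^2)}$, set $x_{t+1}=x_t+s_t$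 and terminate; otherwise set $\tau_t=\Lambda/\|s_t\|$, $x_{t+1}=x_t+\tau_ts_t$ and continue with $t+1$. Choice of inner counts: with $A:=\min\{\varepsilon_1/\ell_1,\ \varepsilon_2/(2L_H)\}$, $$N_1\geqslant2\sqrt\kappa\log\Bigl(\tfrac{\sqrt{\kappa+1}\,\|y_0-y^*(x_1)\|}{A}\Bigr),\qquad N_t\geqslant2\sqrt\kappa\log\Bigl(\tfrac{\sqrt{\kappa+1}\,(A+\kappa\|x_t-x_{t-1}\|)}{A}\Bigr)\ (t\geqslant2)$$ (with $\log 0=-\infty$). It is a known fact that this choice guarantees, for every $t\geqslant1$, $\|y_t-y^*(x_t)\|\leqslant A$, $\|\nabla\mathcal{F}(x_t)-g_t\|\leqslant\varepsilon_1$ and $\|\nabla^2\mathcal{F}(x_t)-H_t\|\leqslant\varepsilon_2$. *)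

theory Defs
  imports "HOL-Analysis.Analysis"
begin

section \<open>Gradients, Hessians and the Loewner order\<close>

definition gradient :: "('a::real_inner \<Rightarrow> real) \<Rightarrow> 'a \<Rightarrow> 'a" where
  "gradient F z = (THE D. GDERIV F z :> D)"

definition jacobian :: "(real^'a \<Rightarrow> real^'b) \<Rightarrow> real^'a \<Rightarrow> real^'a^'b" where
  "jacobian G z = matrix (frechet_derivative G (at z))"

definition hessian :: "(real^'n \<Rightarrow> real) \<Rightarrow> real^'n \<Rightarrow> real^'n^'n" where
  "hessian F = jacobian (gradient F)"

definition twice_differentiable :: "('a::real_inner \<Rightarrow> real) \<Rightarrow> bool" where
  "twice_differentiable F \<longleftrightarrow>
     (\<forall>z. F differentiable (at z)) \<and> (\<forall>z. gradient F differentiable (at z))"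

(* The norm that HOL-Analysis puts on matrices is the Frobenius norm,
   so the induced operator norm needs its own name. *)
definition op_norm :: "real^'a^'b \<Rightarrow> real" where
  "op_norm A = onorm (\<lambda>v. A *v v)"

definition op_lipschitz :: "real \<Rightarrow> ('a::metric_space \<Rightarrow> real^'b^'c) \<Rightarrow> bool" where
  "op_lipschitz C M \<longleftrightarrow> (\<forall>z w. op_norm (M z - M w) \<le> C * dist z w)"

definition positive_semidefinite :: "real^'n^'n \<Rightarrow> bool" where
  "positive_semidefinite A \<longleftrightarrow> transpose A = A \<and> (\<forall>w. 0 \<le> w \<bullet> (A *v w))"

definition loewner_ge :: "real^'n^'n \<Rightarrow> real^'n^'n \<Rightarrow> bool" (infix "\<succeq>" 50) where
  "A \<succeq> B \<longleftrightarrow> positive_semidefinite (A - B)"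

definition strongly_concave :: "real \<Rightarrow> ('a::real_inner \<Rightarrow> real) \<Rightarrow> bool" where
  "strongly_concave \<mu> g \<longleftrightarrow>
     (\<forall>a b. \<forall>t\<in>{0..1}.
        g ((1 - t) *\<^sub>R a + t *\<^sub>R b)
          \<ge> (1 - t) * g a + t * g b + \<mu> / 2 * t * (1 - t) * (norm (a - b))\<^sup>2)"

section \<open>The minimax objective\<close>

definition grad_x :: "((real^'n) \<times> (real^'m) \<Rightarrow> real) \<Rightarrow> (real^'n) \<times> (real^'m) \<Rightarrow> real^'n" where
  "grad_x f = (\<lambda>(x, y). gradient (\<lambda>x'. f (x', y)) x)"

definition grad_y :: "((real^'n) \<times> (real^'m) \<Rightarrow> real) \<Rightarrow> (real^'n) \<times> (real^'m) \<Rightarrow> real^'m" where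
  "grad_y f = (\<lambda>(x, y). gradient (\<lambda>y'. f (x, y')) y)"

(* hess_xy has the derivative of grad_x f with respect to y (an n by m matrix),
   hess_yx the derivative of grad_y f with respect to x (m by n). *)
definition hess_xx :: "((real^'n) \<times> (real^'m) \<Rightarrow> real) \<Rightarrow> (real^'n) \<times> (real^'m) \<Rightarrow> real^'n^'n" where
  "hess_xx f = (\<lambda>(x, y). jacobian (\<lambda>x'. grad_x f (x', y)) x)"

definition hess_xy :: "((real^'n) \<times> (real^'m) \<Rightarrow> real) \<Rightarrow> (real^'n) \<times> (real^'m) \<Rightarrow> real^'m^'n" where
  "hess_xy f = (\<lambda>(x, y). jacobian (\<lambda>y'. grad_x f (x, y')) y)"

definition hess_yx :: "((real^'n) \<times> (real^'m) \<Rightarrow> real) \<Rightarrow> (real^'n) \<times> (real^'m) \<Rightarrow> real^'n^'m" where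
  "hess_yx f = (\<lambda>(x, y). jacobian (\<lambda>x'. grad_y f (x', y)) x)"

definition hess_yy :: "((real^'n) \<times> (real^'m) \<Rightarrow> real) \<Rightarrow> (real^'n) \<times> (real^'m) \<Rightarrow> real^'m^'m" where
  "hess_yy f = (\<lambda>(x, y). jacobian (\<lambda>y'. grad_y f (x, y')) y)"

definition schur_H :: "((real^'n) \<times> (real^'m) \<Rightarrow> real) \<Rightarrow> (real^'n) \<times> (real^'m) \<Rightarrow> real^'n^'n" where
  "schur_H f z = hess_xx f z - hess_xy f z ** matrix_inv (hess_yy f z) ** hess_yx f z"

(* A supremum in form; strong concavity in y makes it a maximum, attained at y_star f x. *)
definition max_value :: "((real^'n) \<times> (real^'m) \<Rightarrow> real) \<Rightarrow> real^'n \<Rightarrow> real" where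
  "max_value f x = (SUP y. f (x, y))"

definition y_star :: "((real^'n) \<times> (real^'m) \<Rightarrow> real) \<Rightarrow> real^'n \<Rightarrow> real^'m" where
  "y_star f x = arg_max (\<lambda>y. f (x, y)) (\<lambda>_. True)"

section \<open>The HSDA algorithm\<close>

(* Inner loop: the pair of y_i and its extrapolation after i accelerated ascent steps along G. *)
primrec accel_ascent ::
  "('a::real_vector \<Rightarrow> 'a) \<Rightarrow> real \<Rightarrow> real \<Rightarrow> 'a \<Rightarrow> nat \<Rightarrow> 'a \<times> 'a" where
  "accel_ascent G \<eta>1 \<eta>2 y0 0 = (y0, y0)"
| "accel_ascent G \<eta>1 \<eta>2 y0 (Suc i) =
     (let (y, z) = accel_ascent G \<eta>1 \<eta>2 y0 i;
          y' = z + \<eta>1 *\<^sub>R G z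
      in (y', y' + \<eta>2 *\<^sub>R (y' - y)))"

(* The product of the block matrix [H, g; g^T, -alpha] with the column [u; v]. The norm of the
   product type real^'n * real is the Euclidean norm of [u; v]. *)
definition bordered_mult ::
  "real^'n^'n \<Rightarrow> real^'n \<Rightarrow> real \<Rightarrow> (real^'n) \<times> real \<Rightarrow> (real^'n) \<times> real" where
  "bordered_mult H g \<alpha> = (\<lambda>(u, v). (H *v u + v *\<^sub>R g, g \<bullet> u - \<alpha> * v))"

(* Differs from the library's sgn at 0. *)
definition sgn1 :: "real \<Rightarrow> real" where
  "sgn1 a = (if a < 0 then - 1 else 1)"

definition stops :: "real \<Rightarrow> (nat \<Rightarrow> real) \<Rightarrow> nat \<Rightarrow> bool" where
  "stops \<Lambda> v t \<longleftrightarrow> \<bar>v t\<bar> > sqrt (1 / (1 + \<Lambda>\<^sup>2))"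

(* Iteration t is executed: no earlier iteration met the termination test. *)
definition reached :: "real \<Rightarrow> (nat \<Rightarrow> real) \<Rightarrow> nat \<Rightarrow> bool" where
  "reached \<Lambda> v t \<longleftrightarrow> t \<ge> 1 \<and> (\<forall>j\<in>{1..<t}. \<not> stops \<Lambda> v j)"

(* The sequences record one run, from the inputs x 1 and y 0. They are infinite only as a coding
   device: after termination their values are unconstrained (x 0, u 0, ... are never used). *)
definition hsda_run ::
  "((real^'n) \<times> (real^'m) \<Rightarrow> real) \<Rightarrow> real \<Rightarrow> real \<Rightarrow> real \<Rightarrow> real \<Rightarrow> real \<Rightarrow> (nat \<Rightarrow> nat) \<Rightarrow>
   (nat \<Rightarrow> real^'n) \<Rightarrow> (nat \<Rightarrow> real^'m) \<Rightarrow> (nat \<Rightarrow> real^'n) \<Rightarrow> (nat \<Rightarrow> real) \<Rightarrow> (nat \<Rightarrow> real^'n) \<Rightarrow> bool"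
where
  "hsda_run f l1 \<kappa> \<omega> \<alpha> \<Lambda> N x y u v s \<longleftrightarrow>
     (\<forall>t. reached \<Lambda> v t \<longrightarrow>
        (let g = grad_x f (x t, y t); H = schur_H f (x t, y t) in
           N t \<ge> 1
         \<and> y t = fst (accel_ascent (\<lambda>z. grad_y f (x t, z)) (1 / l1)
                        ((sqrt \<kappa> - 1) / (sqrt \<kappa> + 1)) (y (t - 1)) (N t))
         \<and> is_arg_min (\<lambda>w. w \<bullet> bordered_mult H g \<alpha> w) (\<lambda>w. norm w \<le> 1) (u t, v t)
         \<and> s t = (if \<bar>v t\<bar> \<ge> \<omega> then u t /\<^sub>R v t else sgn1 (- (g \<bullet> u t)) *\<^sub>R u t)
         \<and> x (t + 1) = (if stops \<Lambda> v t then x t + s t else x t + (\<Lambda> / norm (s t)) *\<^sub>R s t)))"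

(* The convention log 0 = -infinity makes the first bound void when y 0 = y_star f (x 1). Here
   ln 0 = 0 turns it into N 1 \<ge> 0, equally void. The argument of the second ln is positive. *)
definition inner_counts ::
  "((real^'n) \<times> (real^'m) \<Rightarrow> real) \<Rightarrow> real \<Rightarrow> real \<Rightarrow> real \<Rightarrow> (nat \<Rightarrow> nat) \<Rightarrow>
   (nat \<Rightarrow> real^'n) \<Rightarrow> (nat \<Rightarrow> real^'m) \<Rightarrow> (nat \<Rightarrow> real) \<Rightarrow> bool"
where
  "inner_counts f \<kappa> A \<Lambda> N x y v \<longleftrightarrow>
     real (N 1) \<ge> 2 * sqrt \<kappa> * ln (sqrt (\<kappa> + 1) * norm (y 0 - y_star f (x 1)) / A)
   \<and> (\<forall>t\<ge>2. reached \<Lambda> v t \<longrightarrow>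
        real (N t) \<ge> 2 * sqrt \<kappa> * ln (sqrt (\<kappa> + 1) * (A + \<kappa> * norm (x t - x (t - 1))) / A))"

end

(*
  Write F for the value function max_value f. The implicit function y_star f is differentiable, and
  since grad_y f vanishes on its graph the chain rule gives the gradient and the Hessian of F, the
  latter being the Schur complement schur_H f on the graph; it is L2-Lipschitz, because
  x \<mapsto> (x, y_star f x) is (1 + \<kappa>)-Lipschitz and schur_H f is LH-Lipschitz. Nesterov's Lyapunov
  function shows that the inner loop reaches accuracy A, hence g_t and H_t approximate the gradient
  and the Hessian of F up to \<epsilon>1 and \<epsilon>2.
  The minimizer (u, v) of the bordered form is an eigenvector on the unit sphere for an eigenvalue
  -\<theta> \<le> -\<alpha>. While |v| is small, the step of length \<Lambda> decreases the quadratic model by at least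
  \<alpha> \<Lambda>^2 / 2, and the Taylor remainder and the inexactness leave a decrease of 5/24 L2 \<Lambda>^3 of F;
  since F is bounded below, this can happen only finitely often. When |v| is large, s = u / v is
  short, satisfies H s + g = -\<theta> s, and \<theta> is of order \<Lambda>, which makes x + s approximately stationary
  to second order.
*)
theory Submission
  imports Defs
begin

section \<open>Gradients and strong concavity\<close>

text \<open>Everything is measured on one scale: with \<epsilon> = L2 \<Lambda>^2 and \<alpha> = L2
  \<Lambda>, a step of length at most \<Lambda> causes errors of order L2 \<Lambda>^3 in value, L2
  \<Lambda>^2 in gradient and L2 \<Lambda> in Hessian, and the constants of the theorem are sums of
  fractions in these units. The hypothesis \<epsilon> \<le> L2 / 2 becomes \<Lambda>^2 \<le> 1/2. It
  makes u longer than \<Lambda> when v is below \<omega>, keeps v above \<omega> at the stop, and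
  closes the mutual estimate of \<theta> and norm g there. The matrix H_t is formed at the inexact
  point y_t, so symmetry, boundedness and Lipschitz continuity of \<open>schur_H\<close> are needed
  off the graph of \<open>y_star\<close>. The accuracy of the inner loop at one iteration is the
  warm start of the next, hence an induction along the run; since the recorded sequences are
  arbitrary after termination, every such statement carries \<open>reached\<close>.\<close>

lemma gradient_eqI:
  assumes "GDERIV F z :> D"
  shows "gradient F z = D"
  unfolding gradient_def
proof (rule the_equality)
  show "GDERIV F z :> D" by fact
next
  fix E assume "GDERIV F z :> E"
  then have "(\<lambda>h. h \<bullet> E) = (\<lambda>h. h \<bullet> D)"
    using assms has_derivative_unique unfolding gderiv_def by blast
  then have "\<forall>h. h \<bullet> E = h \<bullet> D" by meson
  then show "E = D" by (metis vector_eq_ldot)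
qed

text \<open>Riesz representation in an orthonormal basis supplies the witness for the definite
  description behind \<open>gradient\<close>.\<close>

lemma GDERIV_gradient:
  fixes F :: "'a::euclidean_space \<Rightarrow> real"
  assumes "F differentiable (at z)"
  shows "GDERIV F z :> gradient F z"
proof -
  obtain F' where F': "(F has_derivative F') (at z)"
    using assms unfolding differentiable_def by blast
  interpret bounded_linear F' by (rule has_derivative_bounded_linear[OF F'])
  have "F' h = h \<bullet> (\<Sum>b\<in>Basis. F' b *\<^sub>R b)" for h
  proof -
    have "F' h = F' (\<Sum>b\<in>Basis. (h \<bullet> b) *\<^sub>R b)" by (simp add: euclidean_representation)
    also have "\<dots> = (\<Sum>b\<in>Basis. (h \<bullet> b) * F' b)" by (simp add: sum scaleR)
    finally show ?thesis by (simp add: inner_sum_right mult.commute)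
  qed
  then have "F' = (\<lambda>h. h \<bullet> (\<Sum>b\<in>Basis. F' b *\<^sub>R b))" by (rule ext)
  with F' have "GDERIV F z :> (\<Sum>b\<in>Basis. F' b *\<^sub>R b)"
    unfolding gderiv_def by simp
  then show ?thesis by (simp only: gradient_eqI)
qed

lemma GDERIV_along_line:
  assumes "GDERIV F (p + t *\<^sub>R d) :> D"
  shows "((\<lambda>r. F (p + r *\<^sub>R d)) has_real_derivative d \<bullet> D) (at t)"
proof -
  have "((\<lambda>r. F (p + r *\<^sub>R d)) has_derivative (\<lambda>h. (h *\<^sub>R d) \<bullet> D)) (at t)"
    by (rule has_derivative_compose[where g = F and f = "\<lambda>r. p + r *\<^sub>R d" and g' = "\<lambda>h. h \<bullet> D"])
      (auto intro!: derivative_eq_intros assms[unfolded gderiv_def])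
  then show ?thesis
    unfolding has_field_derivative_def by (simp add: mult.commute[of _ "d \<bullet> D"])
qed

text \<open>Replaces integration over [0, 1]: after subtracting the primitive of the quadratic,
  \<phi> is nonincreasing, so integrability of its derivative never comes up. The Taylor and
  Lipschitz-gradient estimates below are instances along a segment.\<close>

lemma increment_le_of_deriv_le_quadratic:
  fixes \<phi> \<phi>' :: "real \<Rightarrow> real"
  assumes "\<And>t. 0 \<le> t \<Longrightarrow> t \<le> 1 \<Longrightarrow> (\<phi> has_real_derivative \<phi>' t) (at t)"
    and "\<And>t. 0 \<le> t \<Longrightarrow> t \<le> 1 \<Longrightarrow> \<phi>' t \<le> a + b * t + c * t\<^sup>2"
  shows "\<phi> 1 \<le> \<phi> 0 + a + b / 2 + c / 3"
proof -
  define q where "q = (\<lambda>t. \<phi> t - (a * t + b * t\<^sup>2 / 2 + c * t ^ 3 / 3))"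
  have "\<exists>y. (q has_real_derivative y) (at t) \<and> y \<le> 0" if t: "0 \<le> t" "t \<le> 1" for t
  proof -
    have "((\<lambda>t. a * t + b * t\<^sup>2 / 2 + c * t ^ 3 / 3) has_real_derivative a + b * t + c * t\<^sup>2) (at t)"
      by (rule derivative_eq_intros refl | simp)+
    from DERIV_diff[OF assms(1)[OF t] this]
    have "(q has_real_derivative \<phi>' t - (a + b * t + c * t\<^sup>2)) (at t)"
      unfolding q_def .
    moreover have "\<phi>' t - (a + b * t + c * t\<^sup>2) \<le> 0" using assms(2)[OF t] by simp
    ultimately show ?thesis by blast
  qed
  then have "q 1 \<le> q 0"
    by (intro DERIV_nonpos_imp_nonincreasing[of 0 1 q]) auto
  then show ?thesis by (simp add: q_def)
qed

lemma lipschitz_gradient_lower_bound: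
  assumes "\<And>z. GDERIV F z :> G z" and "\<And>p q. norm (G p - G q) \<le> L * norm (p - q)"
  shows "F b \<ge> F a + G a \<bullet> (b - a) - L / 2 * (norm (b - a))\<^sup>2"
proof -
  define d where "d = b - a"
  have "(\<lambda>t. - F (a + t *\<^sub>R d)) 1
      \<le> (\<lambda>t. - F (a + t *\<^sub>R d)) 0 + - (d \<bullet> G a) + L * (norm d)\<^sup>2 / 2 + 0 / 3"
  proof (rule increment_le_of_deriv_le_quadratic)
    fix t :: real assume t: "0 \<le> t" "t \<le> 1"
    show "((\<lambda>t. - F (a + t *\<^sub>R d)) has_real_derivative - (d \<bullet> G (a + t *\<^sub>R d))) (at t)"
      by (intro DERIV_minus GDERIV_along_line assms)
    have "- (d \<bullet> (G (a + t *\<^sub>R d) - G a)) \<le> norm d * norm (G (a + t *\<^sub>R d) - G a)"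
      using norm_cauchy_schwarz[of "- d"] by simp
    also have "\<dots> \<le> norm d * (L * norm (t *\<^sub>R d))"
      using assms(2)[of "a + t *\<^sub>R d" a] by (intro mult_left_mono) auto
    finally show "- (d \<bullet> G (a + t *\<^sub>R d)) \<le> - (d \<bullet> G a) + L * (norm d)\<^sup>2 * t + 0 * t\<^sup>2"
      using t by (simp add: inner_diff_right power2_eq_square algebra_simps)
  qed
  then show ?thesis unfolding d_def by (simp add: inner_commute)
qed

text \<open>Dividing the concavity inequality on the segment by t and letting t tend to 0 from the
  right yields a supporting paraboloid; only the derivative at \<open>a\<close> enters.\<close>

lemma strongly_concave_upper_bound:
  assumes "strongly_concave \<mu> F" and "GDERIV F a :> G"
  shows "F b \<le> F a + G \<bullet> (b - a) - \<mu> / 2 * (norm (b - a))\<^sup>2"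
proof -
  define d where "d = b - a"
  define n where "n = \<mu> / 2 * (norm d)\<^sup>2"
  have "((\<lambda>t. F (a + t *\<^sub>R d)) has_real_derivative d \<bullet> G) (at 0)"
    using assms(2) by (intro GDERIV_along_line) simp
  then have 1: "((\<lambda>t. (F (a + t *\<^sub>R d) - F a) / t) \<longlongrightarrow> d \<bullet> G) (at_right 0)"
    unfolding has_field_derivative_iff by (simp add: filterlim_at_split)
  have 2: "((\<lambda>t. F b - F a + n * (1 - t)) \<longlongrightarrow> F b - F a + n * (1 - 0)) (at_right 0)"
    by (intro tendsto_intros)
  have "F b - F a + n * (1 - 0) \<le> d \<bullet> G"
  proof (rule tendsto_le[OF _ 1 2])
    have "F b - F a + n * (1 - t) \<le> (F (a + t *\<^sub>R d) - F a) / t" if t: "0 < t" "t < 1" for t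
    proof -
      have "a + t *\<^sub>R d = (1 - t) *\<^sub>R a + t *\<^sub>R b" by (simp add: d_def algebra_simps)
      then have "F (a + t *\<^sub>R d) \<ge> (1 - t) * F a + t * F b + n * t * (1 - t)"
        using assms(1)[unfolded strongly_concave_def, rule_format, of t a b] t
        by (simp add: n_def d_def norm_minus_commute mult_ac)
      then have "t * (F b - F a + n * (1 - t)) \<le> F (a + t *\<^sub>R d) - F a"
        by (simp add: algebra_simps)
      then show ?thesis using t by (simp add: field_simps)
    qed
    then show "\<forall>\<^sub>F t in at_right 0. F b - F a + n * (1 - t) \<le> (F (a + t *\<^sub>R d) - F a) / t"
      unfolding eventually_at_right_field by (meson zero_less_one)
  qed simp
  then show ?thesis by (simp add: n_def d_def inner_commute)
qed

lemma strongly_concave_max_exists: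
  fixes F :: "'a::euclidean_space \<Rightarrow> real"
  assumes "strongly_concave \<mu> F" "\<mu> > 0" "\<And>z. F differentiable (at z)"
  shows "\<exists>y. \<forall>z. F z \<le> F y"
proof -
  define G where "G = gradient F 0"
  have ub: "F b \<le> F 0 + G \<bullet> b - \<mu> / 2 * (norm b)\<^sup>2" for b
    using strongly_concave_upper_bound[OF assms(1) GDERIV_gradient[OF assms(3)], of b 0]
    by (simp add: G_def)
  \<comment> \<open>Beyond this radius the quadratic term of \<open>ub\<close> outweighs the linear
    one, so F stays below \<open>F 0\<close> and the maximum over the compact ball is
    global.\<close>
  define R where "R = 2 * norm G / \<mu>"
  have R: "R \<ge> 0" using assms(2) by (simp add: R_def)
  have "continuous_on (cball 0 R) F"
    using assms(3) by (simp add: continuous_at_imp_continuous_on differentiable_imp_continuous_within)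
  then obtain y where y: "y \<in> cball 0 R" "\<forall>z\<in>cball 0 R. F z \<le> F y"
    using continuous_attains_sup[of "cball 0 R" F] R by auto
  have "F z \<le> F y" if "norm z > R" for z
  proof -
    have "norm G \<le> \<mu> / 2 * norm z" using that assms(2) by (simp add: R_def field_simps)
    then have "norm G * norm z \<le> \<mu> / 2 * norm z * norm z" by (intro mult_right_mono) auto
    then have "G \<bullet> z \<le> \<mu> / 2 * (norm z)\<^sup>2"
      using norm_cauchy_schwarz[of G z] by (simp add: power2_eq_square)
    then have "F z \<le> F 0" using ub[of z] by simp
    also have "\<dots> \<le> F y" using y R by simp
    finally show ?thesis .
  qed
  then show ?thesis using y(2) by (metis mem_cball_0 not_le)
qed

lemma gradient_zero_at_max:
  assumes "GDERIV F y :> G" "\<And>z. F z \<le> F y"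
  shows "G = 0"
proof -
  have "(\<lambda>h. h \<bullet> G) = (\<lambda>h. 0)"
    using differential_zero_maxmin[of y UNIV F "\<lambda>h. h \<bullet> G"] assms unfolding gderiv_def by auto
  then have "G \<bullet> G = 0" by meson
  then show ?thesis by simp
qed

(* Both sides are the limit of the second difference quotient of F, which is symmetric in h and k.
   The mean value theorem gives this from differentiability of G at the single point z. *)
lemma derivative_of_gradient_symmetric:
  assumes "\<And>p. GDERIV F p :> G p" and "(G has_derivative A) (at z)"
  shows "h \<bullet> A k = k \<bullet> A h"
proof -
  interpret bounded_linear A by (rule has_derivative_bounded_linear[OF assms(2)])
  define S where "S = norm h + norm k"
  have est: "\<exists>\<delta>>0. \<forall>t. 0 < t \<and> t < \<delta> \<longrightarrow>
      \<bar>F (z + t *\<^sub>R h + t *\<^sub>R k) - F (z + t *\<^sub>R h) - F (z + t *\<^sub>R k) + F z - t\<^sup>2 * (h \<bullet> A k)\<bar>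
        \<le> 2 * e * t\<^sup>2 * (norm h + norm k)\<^sup>2"
    if "e > 0" for e and h k :: 'a
  proof -
    define S where "S = norm h + norm k"
    have S: "S \<ge> 0" "norm h \<le> S" "norm k \<le> S" by (auto simp: S_def)
    obtain d where d: "d > 0" "\<And>q. norm (q - z) < d \<Longrightarrow> norm (G q - G z - A (q - z)) \<le> e * norm (q - z)"
      using assms(2) \<open>e > 0\<close> unfolding has_derivative_at_alt by meson
    have "\<bar>F (z + t *\<^sub>R h + t *\<^sub>R k) - F (z + t *\<^sub>R h) - F (z + t *\<^sub>R k) + F z - t\<^sup>2 * (h \<bullet> A k)\<bar>
        \<le> 2 * e * t\<^sup>2 * S\<^sup>2" if t: "0 < t" "t < d / (S + 1)" for t
    proof -
      define \<phi> where "\<phi> = (\<lambda>r. F ((z + t *\<^sub>R k) + r *\<^sub>R h) - F (z + r *\<^sub>R h))"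
      have d\<phi>: "(\<phi> has_real_derivative (h \<bullet> G ((z + t *\<^sub>R k) + r *\<^sub>R h) - h \<bullet> G (z + r *\<^sub>R h))) (at r)" for r
        unfolding \<phi>_def by (intro DERIV_diff GDERIV_along_line assms)
      obtain \<xi> where \<xi>: "0 < \<xi>" "\<xi> < t"
        "\<phi> t - \<phi> 0 = (t - 0) * (h \<bullet> G ((z + t *\<^sub>R k) + \<xi> *\<^sub>R h) - h \<bullet> G (z + \<xi> *\<^sub>R h))"
        using MVT2[OF t(1) d\<phi>] by blast
      have tS: "t * S < d"
      proof -
        have "t * S \<le> t * (S + 1)" using t by simp
        also have "\<dots> < d" using t S by (simp add: pos_less_divide_eq)
        finally show ?thesis .
      qed
      have *: "norm (G (z + w) - G z - A w) \<le> e * (t * S)" if "norm w \<le> t * S" for w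
      proof -
        have "norm (G (z + w) - G z - A w) \<le> e * norm w" using d(2)[of "z + w"] that tS by simp
        also have "\<dots> \<le> e * (t * S)" using that \<open>e > 0\<close> by simp
        finally show ?thesis .
      qed
      have \<xi>h: "norm (\<xi> *\<^sub>R h) \<le> t * norm h" using \<xi> by (simp add: mult_right_mono)
      then have n1: "norm (\<xi> *\<^sub>R h) \<le> t * S"
        using mult_left_mono[OF S(2), of t] t by linarith
      have n2: "norm (t *\<^sub>R k + \<xi> *\<^sub>R h) \<le> t * S"
        using \<xi>h t norm_triangle_ineq[of "t *\<^sub>R k" "\<xi> *\<^sub>R h"] by (simp add: S_def algebra_simps)
      \<comment> \<open>The derivative of G is available only at z. The increment of G across t k is
        therefore a difference of two increments from z, each with its own remainder.\<close>
      define r where "r = (G (z + (t *\<^sub>R k + \<xi> *\<^sub>R h)) - G z - A (t *\<^sub>R k + \<xi> *\<^sub>R h))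
          - (G (z + \<xi> *\<^sub>R h) - G z - A (\<xi> *\<^sub>R h))"
      have r: "norm r \<le> 2 * (e * (t * S))"
        unfolding r_def
        using *[OF n1] *[OF n2] by (intro order_trans[OF norm_triangle_ineq4]) linarith
      have "G (z + t *\<^sub>R k + \<xi> *\<^sub>R h) - G (z + \<xi> *\<^sub>R h) = t *\<^sub>R A k + r"
        by (simp add: r_def add scaleR algebra_simps)
      then have "\<phi> t - \<phi> 0 = t * (h \<bullet> (t *\<^sub>R A k + r))"
        using \<xi>(3) by (simp add: inner_diff_right[symmetric])
      then have "\<phi> t - \<phi> 0 - t\<^sup>2 * (h \<bullet> A k) = t * (h \<bullet> r)"
        by (simp add: inner_add_right power2_eq_square algebra_simps)
      moreover have "\<bar>t * (h \<bullet> r)\<bar> \<le> t * (S * (2 * (e * (t * S))))"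
      proof -
        have "\<bar>h \<bullet> r\<bar> \<le> norm h * norm r" by (rule Cauchy_Schwarz_ineq2)
        also have "\<dots> \<le> S * (2 * (e * (t * S)))" using S r by (intro mult_mono) auto
        finally show ?thesis using t by (simp add: abs_mult)
      qed
      moreover have "\<phi> t - \<phi> 0 = F (z + t *\<^sub>R h + t *\<^sub>R k) - F (z + t *\<^sub>R h) - F (z + t *\<^sub>R k) + F z"
        by (simp add: \<phi>_def algebra_simps)
      ultimately show ?thesis by (simp add: power2_eq_square algebra_simps)
    qed
    moreover have "d / (S + 1) > 0" using d(1) S by (simp add: divide_pos_pos)
    ultimately show ?thesis unfolding S_def by blast
  qed
  have bound: "\<bar>h \<bullet> A k - k \<bullet> A h\<bar> \<le> e * (4 * S\<^sup>2)" if e: "e > 0" for e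
  proof -
    obtain d1 where d1: "d1 > 0" "\<And>t. 0 < t \<and> t < d1 \<Longrightarrow>
      \<bar>F (z + t *\<^sub>R h + t *\<^sub>R k) - F (z + t *\<^sub>R h) - F (z + t *\<^sub>R k) + F z - t\<^sup>2 * (h \<bullet> A k)\<bar>
        \<le> 2 * e * t\<^sup>2 * (norm h + norm k)\<^sup>2"
      using est[OF e] by blast
    obtain d2 where d2: "d2 > 0" "\<And>t. 0 < t \<and> t < d2 \<Longrightarrow>
      \<bar>F (z + t *\<^sub>R k + t *\<^sub>R h) - F (z + t *\<^sub>R k) - F (z + t *\<^sub>R h) + F z - t\<^sup>2 * (k \<bullet> A h)\<bar>
        \<le> 2 * e * t\<^sup>2 * (norm k + norm h)\<^sup>2"
      using est[OF e] by blast
    obtain t where t: "0 < t" "t < d1" "t < d2"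
      using d1(1) d2(1) by (meson dense min_less_iff_conj)
    have sw: "z + t *\<^sub>R k + t *\<^sub>R h = z + t *\<^sub>R h + t *\<^sub>R k" by simp
    have "\<bar>t\<^sup>2 * (h \<bullet> A k) - t\<^sup>2 * (k \<bullet> A h)\<bar> \<le> 4 * e * t\<^sup>2 * S\<^sup>2"
      using d1(2)[of t] d2(2)[of t] t unfolding sw S_def add.commute[of "norm k"] by linarith
    moreover have "\<bar>t\<^sup>2 * (h \<bullet> A k) - t\<^sup>2 * (k \<bullet> A h)\<bar> = t\<^sup>2 * \<bar>h \<bullet> A k - k \<bullet> A h\<bar>"
      by (simp add: abs_mult flip: right_diff_distrib)
    ultimately have "t\<^sup>2 * \<bar>h \<bullet> A k - k \<bullet> A h\<bar> \<le> t\<^sup>2 * (e * (4 * S\<^sup>2))"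
      by (simp add: mult_ac)
    then show ?thesis using t by simp
  qed
  have "\<bar>h \<bullet> A k - k \<bullet> A h\<bar> \<le> 0"
  proof (rule field_le_epsilon)
    fix e :: real assume e: "e > 0"
    \<comment> \<open>The added 1 keeps the divisor positive when h = k = 0.\<close>
    have "e / (4 * S\<^sup>2 + 1) > 0" using e by (simp add: add_nonneg_pos)
    from bound[OF this] have "\<bar>h \<bullet> A k - k \<bullet> A h\<bar> \<le> e / (4 * S\<^sup>2 + 1) * (4 * S\<^sup>2)" .
    also have "\<dots> \<le> e"
    proof -
      have "0 < 4 * S\<^sup>2 + 1" by (simp add: add_nonneg_pos)
      then show ?thesis using e by (simp add: pos_divide_le_eq)
    qed
    finally show "\<bar>h \<bullet> A k - k \<bullet> A h\<bar> \<le> 0 + e" by simp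
  qed
  then show ?thesis by simp
qed

section \<open>Accelerated ascent and quadratic forms\<close>

(* w is the auxiliary sequence of Nesterov's method: z is a convex combination of y and w. *)
lemma accel_ascent_step:
  fixes G :: "'a::real_inner \<Rightarrow> 'a"
  assumes up: "\<And>a b. F b \<le> F a + G a \<bullet> (b - a) - \<mu> / 2 * (norm (b - a))\<^sup>2"
    and lo: "\<And>a b. F b \<ge> F a + G a \<bullet> (b - a) - L / 2 * (norm (b - a))\<^sup>2"
    and "0 < \<rho>" "\<rho> \<le> 1" "0 < L" "\<mu> = \<rho>\<^sup>2 * L"
    and zy: "z - y = \<rho> *\<^sub>R (w - z)"
    and y': "y' = z + (1 / L) *\<^sub>R G z"
    and w': "w' = y + (1 / \<rho>) *\<^sub>R (y' - y)"
  shows "F q - F y' + \<mu> / 2 * (norm (w' - q))\<^sup>2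
    \<le> (1 - \<rho>) * (F q - F y + \<mu> / 2 * (norm (w - q))\<^sup>2)"
proof -
  define g a b where "g = G z" and "a = w - q" and "b = z - q"
  \<comment> \<open>Relative to q, this is the point (1 - \<rho>) w + \<rho> z. The coupling
    \<open>zy\<close> makes w' a gradient step of length 1 / (\<rho> L) from it.\<close>
  define c where "c = (1 - \<rho>) *\<^sub>R a + \<rho> *\<^sub>R b"
  have \<mu>: "\<mu> > 0" using assms by simp
  have wz: "z - y = \<rho> *\<^sub>R (a - b)" using zy by (simp add: a_def b_def)
  have "w' - q = (z - q) - (z - y) + (1 / \<rho>) *\<^sub>R ((z - y) + (1 / L) *\<^sub>R g)"
    by (simp add: w' y' g_def algebra_simps)
  also have "\<dots> = b - \<rho> *\<^sub>R (a - b) + (a - b) + (1 / (\<rho> * L)) *\<^sub>R g"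
    using assms(3) by (simp add: wz b_def scaleR_add_right)
  also have "\<dots> = c + (1 / (\<rho> * L)) *\<^sub>R g"
    by (simp add: c_def algebra_simps)
  finally have w'q: "w' - q = c + (1 / (\<rho> * L)) *\<^sub>R g" .
  have "(norm (c + e *\<^sub>R g))\<^sup>2 = (norm c)\<^sup>2 + 2 * e * (g \<bullet> c) + e\<^sup>2 * (norm g)\<^sup>2" for e
    unfolding power2_norm_eq_inner
    by (simp add: inner_add_left inner_add_right inner_commute[of c g] power2_eq_square algebra_simps)
  then have "\<mu> / 2 * (norm (w' - q))\<^sup>2
      = \<mu> / 2 * (norm c)\<^sup>2 + \<mu> / (\<rho> * L) * (g \<bullet> c) + \<mu> / 2 * (1 / (\<rho> * L))\<^sup>2 * (norm g)\<^sup>2"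
    unfolding w'q by (simp add: distrib_left)
  \<comment> \<open>The relation \<mu> = \<rho>^2 L is chosen so that the squared gradient gets
    weight 1 / (2 L), exactly what the gradient step from z gains in fact 3.\<close>
  also have "\<mu> / (\<rho> * L) = \<rho>" using assms by (simp add: power2_eq_square)
  also have "\<mu> / 2 * (1 / (\<rho> * L))\<^sup>2 = 1 / (2 * L)" using assms by (simp add: power2_eq_square)
  finally have 1: "\<mu> / 2 * (norm (w' - q))\<^sup>2 = \<mu> / 2 * (norm c)\<^sup>2 + \<rho> * (g \<bullet> c) + 1 / (2 * L) * (norm g)\<^sup>2" .
  have "(1 - \<rho>) * (norm a)\<^sup>2 + \<rho> * (norm b)\<^sup>2 - (norm c)\<^sup>2 = \<rho> * (1 - \<rho>) * (norm (a - b))\<^sup>2"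
    by (simp add: c_def power2_norm_eq_inner inner_add_left inner_add_right inner_diff_left
        inner_diff_right inner_commute algebra_simps)
  also have "\<dots> \<ge> 0" using assms by simp
  finally have "(norm c)\<^sup>2 \<le> (1 - \<rho>) * (norm a)\<^sup>2 + \<rho> * (norm b)\<^sup>2" by simp
  then have 2: "\<mu> / 2 * (norm c)\<^sup>2 \<le> \<mu> / 2 * ((1 - \<rho>) * (norm a)\<^sup>2 + \<rho> * (norm b)\<^sup>2)"
    using \<mu> by (intro mult_left_mono) auto
  have "F z + g \<bullet> ((1 / L) *\<^sub>R g) - L / 2 * (norm ((1 / L) *\<^sub>R g))\<^sup>2 \<le> F y'"
    using lo[of z y'] by (simp add: y' g_def)
  moreover have "g \<bullet> ((1 / L) *\<^sub>R g) - L / 2 * (norm ((1 / L) *\<^sub>R g))\<^sup>2 = 1 / (2 * L) * (norm g)\<^sup>2"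
    using assms(5) by (simp add: power_divide power2_norm_eq_inner) (simp add: power2_eq_square field_simps)
  ultimately have 3: "F z + 1 / (2 * L) * (norm g)\<^sup>2 \<le> F y'" by linarith
  have "0 \<le> \<mu> / 2 * (norm (y - z))\<^sup>2" using \<mu> by simp
  then have "F y \<le> F z + g \<bullet> (y - z)"
    using up[of y z] unfolding g_def by linarith
  moreover have "y - z = - (\<rho> *\<^sub>R (a - b))" using wz by (metis minus_diff_eq)
  ultimately have "F y \<le> F z - \<rho> * (g \<bullet> a - g \<bullet> b)"
    by (simp add: inner_diff_right)
  then have 4: "(1 - \<rho>) * F y \<le> (1 - \<rho>) * (F z - \<rho> * (g \<bullet> a - g \<bullet> b))"
    using assms by (intro mult_left_mono) auto
  have "F q \<le> F z - g \<bullet> b - \<mu> / 2 * (norm b)\<^sup>2"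
    using up[of q z] by (simp add: g_def b_def norm_minus_commute inner_diff_right)
  then have 5: "\<rho> * F q \<le> \<rho> * (F z - g \<bullet> b - \<mu> / 2 * (norm b)\<^sup>2)"
    using assms by (intro mult_left_mono) auto
  have "g \<bullet> c = (1 - \<rho>) * (g \<bullet> a) + \<rho> * (g \<bullet> b)" by (simp add: c_def inner_add_right)
  then have 6: "\<rho> * (g \<bullet> c) = \<rho> * ((1 - \<rho>) * (g \<bullet> a) + \<rho> * (g \<bullet> b))" by simp
  \<comment> \<open>The gap between the two sides is the sum of the slacks in facts 2, 3, 4 and 5.
    The gradient term is abstracted to \<open>e\<close> to keep the identity free of 1 / L.\<close>
  have "(1 - \<rho>) * (F q - F y + \<mu> / 2 * (norm a)\<^sup>2)
      - (F q - F y' + (\<mu> / 2 * (norm c)\<^sup>2 + \<rho> * ((1 - \<rho>) * (g \<bullet> a) + \<rho> * (g \<bullet> b)) + e))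
    = (\<mu> / 2 * ((1 - \<rho>) * (norm a)\<^sup>2 + \<rho> * (norm b)\<^sup>2) - \<mu> / 2 * (norm c)\<^sup>2)
      + (F y' - (F z + e)) + ((1 - \<rho>) * (F z - \<rho> * (g \<bullet> a - g \<bullet> b)) - (1 - \<rho>) * F y)
      + (\<rho> * (F z - g \<bullet> b - \<mu> / 2 * (norm b)\<^sup>2) - \<rho> * F q)" for e
    by (simp add: field_simps)
  from this[of "1 / (2 * L) * (norm g)\<^sup>2"] show ?thesis
    unfolding a_def[symmetric] 1 6 using 2 3 4 5 by linarith
qed

text \<open>The step lemma is applied with \<rho> = 1 / sqrt \<kappa>. The auxiliary point is not
  stored by the loop but recovered from the pair as z + sqrt \<kappa> (z - y), and the extrapolation
  weight is the one for which this recovery follows the recursion of w. Initially both points are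
  y0, so w is y0 too.\<close>

lemma accel_ascent_lyapunov:
  fixes G :: "'a::real_inner \<Rightarrow> 'a"
  assumes up: "\<And>a b. F b \<le> F a + G a \<bullet> (b - a) - \<mu> / 2 * (norm (b - a))\<^sup>2"
    and lo: "\<And>a b. F b \<ge> F a + G a \<bullet> (b - a) - L / 2 * (norm (b - a))\<^sup>2"
    and "0 < \<mu>" "\<mu> \<le> L" and \<kappa>: "\<kappa> = L / \<mu>"
  shows "case accel_ascent G (1 / L) ((sqrt \<kappa> - 1) / (sqrt \<kappa> + 1)) y0 n of (y, z) \<Rightarrow>
    F q - F y + \<mu> / 2 * (norm (z + sqrt \<kappa> *\<^sub>R (z - y) - q))\<^sup>2
      \<le> (1 - 1 / sqrt \<kappa>) ^ n * (F q - F y0 + \<mu> / 2 * (norm (y0 - q))\<^sup>2)"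
proof (induction n)
  case 0
  then show ?case by simp
next
  case (Suc n)
  define r where "r = sqrt \<kappa>"
  have "\<kappa> \<ge> 1" using assms by simp
  then have r: "r \<ge> 1" "r\<^sup>2 = \<kappa>" by (auto simp: r_def)
  obtain y z where yz: "accel_ascent G (1 / L) ((r - 1) / (r + 1)) y0 n = (y, z)"
    by fastforce
  define y' where "y' = z + (1 / L) *\<^sub>R G z"
  define z' where "z' = y' + ((r - 1) / (r + 1)) *\<^sub>R (y' - y)"
  define w where "w = z + r *\<^sub>R (z - y)"
  define w' where "w' = z' + r *\<^sub>R (z' - y')"
  have c: "(1 + r) * ((r - 1) / (r + 1)) = r - 1" using r(1) by (simp add: field_simps)
  have "w' = y' + ((1 + r) * ((r - 1) / (r + 1))) *\<^sub>R (y' - y)"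
    by (simp only: w'_def z'_def distrib_right mult_1 scaleR_left_distrib) simp
  then have w': "w' = y + (1 / (1 / r)) *\<^sub>R (y' - y)"
    unfolding c by (simp add: algebra_simps)
  have \<mu>: "\<mu> = (1 / r)\<^sup>2 * L"
    using assms r by (simp add: power_divide)
  have L: "L > 0" using assms by simp
  have zy: "z - y = (1 / r) *\<^sub>R (w - z)" using r by (simp add: w_def)
  have r1: "0 < 1 / r" "1 / r \<le> 1" using r by auto
  have "F q - F y' + \<mu> / 2 * (norm (w' - q))\<^sup>2
      \<le> (1 - 1 / r) * (F q - F y + \<mu> / 2 * (norm (w - q))\<^sup>2)"
    by (rule accel_ascent_step[OF up lo r1 L \<mu> zy y'_def w'])
  also have "\<dots> \<le> (1 - 1 / r) * ((1 - 1 / r) ^ n * (F q - F y0 + \<mu> / 2 * (norm (y0 - q))\<^sup>2))"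
    using Suc.IH r1 yz unfolding r_def[symmetric] w_def by (intro mult_left_mono) auto
  finally show ?case
    unfolding r_def[symmetric] using yz
    by (simp add: y'_def z'_def w'_def Let_def mult_ac)
qed

text \<open>At a critical point q the initial Lyapunov value is at most \<mu>/2 (\<kappa> + 1) times
  the squared distance, which is the origin of sqrt (\<kappa> + 1). Strong concavity turns the final
  gap back into a squared distance, hence the factor 2 in front of sqrt \<kappa> in the
  count.\<close>

lemma accel_ascent_accuracy:
  fixes G :: "'a::real_inner \<Rightarrow> 'a"
  assumes up: "\<And>a b. F b \<le> F a + G a \<bullet> (b - a) - \<mu> / 2 * (norm (b - a))\<^sup>2"
    and lo: "\<And>a b. F b \<ge> F a + G a \<bullet> (b - a) - L / 2 * (norm (b - a))\<^sup>2"
    and "0 < \<mu>" "\<mu> \<le> L" and \<kappa>: "\<kappa> = L / \<mu>" and crit: "G q = 0"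
    and r: "norm (y0 - q) \<le> r" and "0 < A"
    and n: "2 * sqrt \<kappa> * ln (sqrt (\<kappa> + 1) * r / A) \<le> real n"
  shows "norm (fst (accel_ascent G (1 / L) ((sqrt \<kappa> - 1) / (sqrt \<kappa> + 1)) y0 n) - q) \<le> A"
proof -
  define k where "k = sqrt \<kappa>"
  have "\<kappa> \<ge> 1" using assms by simp
  then have k: "k \<ge> 1" "k\<^sup>2 = \<kappa>" by (auto simp: k_def)
  define c where "c = sqrt (\<kappa> + 1)"
  have c: "c > 0" "c\<^sup>2 = \<kappa> + 1" using \<open>\<kappa> \<ge> 1\<close> by (auto simp: c_def)
  define d where "d = norm (y0 - q)"
  obtain y z where yz: "accel_ascent G (1 / L) ((sqrt \<kappa> - 1) / (sqrt \<kappa> + 1)) y0 n = (y, z)"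
    by fastforce
  have k1: "0 \<le> 1 - 1 / k" using k by simp
  have "\<mu> / 2 * (norm (y - q))\<^sup>2 \<le> F q - F y"
    using up[of y q] crit by simp
  also have "\<dots> \<le> F q - F y + \<mu> / 2 * (norm (z + sqrt \<kappa> *\<^sub>R (z - y) - q))\<^sup>2"
    using assms(3) by simp
  also have "\<dots> \<le> (1 - 1 / k) ^ n * (F q - F y0 + \<mu> / 2 * d\<^sup>2)"
    using accel_ascent_lyapunov[OF up lo assms(3-5), of q n y0] yz
    by (simp only: k_def d_def prod.case)
  also have "\<dots> \<le> (1 - 1 / k) ^ n * (L / 2 * d\<^sup>2 + \<mu> / 2 * d\<^sup>2)"
    using lo[of q y0] crit k1 by (intro mult_left_mono) (auto simp: d_def)
  also have "\<dots> = \<mu> / 2 * ((1 - 1 / k) ^ n * (c * d)\<^sup>2)"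
  proof -
    have 1: "L + \<mu> = \<mu> * c\<^sup>2" using assms(3) c by (simp add: \<kappa> distrib_left)
    have "L / 2 * d\<^sup>2 + \<mu> / 2 * d\<^sup>2 = (L + \<mu>) / 2 * d\<^sup>2"
      by (simp add: field_simps)
    then show ?thesis unfolding 1 by (simp only: power_mult_distrib) simp
  qed
  finally have 1: "(norm (y - q))\<^sup>2 \<le> (1 - 1 / k) ^ n * (c * d)\<^sup>2"
    using assms(3) by simp
  also have "\<dots> \<le> A\<^sup>2"
  proof (cases "r > 0")
    case True
    have "1 - 1 / k \<le> exp (- (1 / k))" using exp_ge_add_one_self[of "- (1 / k)"] by simp
    then have "(1 - 1 / k) ^ n \<le> exp (- (1 / k)) ^ n" using k1 by (intro power_mono)
    also have "\<dots> = exp (- (real n / k))"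
      by (simp add: exp_of_nat_mult[symmetric])
    also have "\<dots> \<le> exp (- (2 * ln (c * r / A)))"
    proof -
      have "2 * ln (c * r / A) \<le> real n / k"
        using n k by (simp add: k_def c_def field_simps)
      then show ?thesis by simp
    qed
    also have "\<dots> = inverse (exp (ln (c * r / A)) ^ 2)"
      by (simp add: exp_minus exp_double)
    also have "\<dots> = (A / (c * r))\<^sup>2"
      using True c \<open>0 < A\<close> by (simp add: power_divide power_mult_distrib field_simps)
    finally have "(1 - 1 / k) ^ n * (c * d)\<^sup>2 \<le> (A / (c * r))\<^sup>2 * (c * r)\<^sup>2"
      using r c k1 by (intro mult_mono power_mono) (auto simp: d_def)
    then show ?thesis using True c by (simp flip: power_mult_distrib)
  next
    \<comment> \<open>Here r = 0 and the logarithm carries no information, but the start is q itself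
      and the right-hand side of fact 1 vanishes.\<close>
    case False
    then have "d = 0" using r norm_ge_zero[of "y0 - q"] unfolding d_def by linarith
    then show ?thesis by simp
  qed
  finally have "norm (y - q) \<le> A" using \<open>0 < A\<close> by (auto intro: power2_le_imp_le)
  then show ?thesis by (simp add: yz)
qed

text \<open>By homogeneity the minimum over the ball bounds the form everywhere, and a negative
  minimum forces m onto the sphere. Then B + \<theta> I is positive semidefinite with value zero at
  m; perturbing m along h = B m + \<theta> m shows that m lies in its kernel.\<close>

lemma quadratic_form_ball_minimizer:
  fixes B :: "'a::real_inner \<Rightarrow> 'a"
  assumes "linear B" and sym: "\<And>a b. a \<bullet> B b = b \<bullet> B a"
    and min: "is_arg_min (\<lambda>w. w \<bullet> B w) (\<lambda>w. norm w \<le> 1) m"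
    and \<theta>: "\<theta> = - (m \<bullet> B m)" "\<theta> > 0"
  shows "norm m = 1" and "B m = - \<theta> *\<^sub>R m" and "w \<bullet> B w \<ge> - \<theta> * (norm w)\<^sup>2"
proof -
  interpret linear B by fact
  have m: "norm m \<le> 1" "\<And>w. norm w \<le> 1 \<Longrightarrow> - \<theta> \<le> w \<bullet> B w"
    using min \<theta> by (force simp: is_arg_min_def)+
  have lower: "w \<bullet> B w \<ge> - \<theta> * (norm w)\<^sup>2" for w
  proof (cases "w = 0")
    case False
    then have "norm (w /\<^sub>R norm w) \<le> 1" by simp
    then have "- \<theta> \<le> (w /\<^sub>R norm w) \<bullet> B (w /\<^sub>R norm w)" by (rule m(2))
    also have "\<dots> = (w \<bullet> B w) / (norm w)\<^sup>2"
      by (simp add: scaleR power2_eq_square field_simps)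
    finally show ?thesis using False by (simp add: field_simps)
  qed simp
  then show "w \<bullet> B w \<ge> - \<theta> * (norm w)\<^sup>2" .
  have "\<theta> \<le> \<theta> * (norm m)\<^sup>2" using lower[of m] \<theta> by simp
  then have "1 \<le> (norm m)\<^sup>2" using \<theta> by simp
  then have "\<not> norm m < 1" using power_less_one_iff[of "norm m" 2] by simp
  then show n1: "norm m = 1" using m(1) by simp
  define h where "h = B m + \<theta> *\<^sub>R m"
  define p where "p = h \<bullet> B h + \<theta> * (norm h)\<^sup>2"
  have p: "p \<ge> 0" using lower[of h] by (simp add: p_def)
  have "0 \<le> 2 * t * (norm h)\<^sup>2 + t\<^sup>2 * p" for t
  proof -
    have "0 \<le> (m + t *\<^sub>R h) \<bullet> B (m + t *\<^sub>R h) + \<theta> * (norm (m + t *\<^sub>R h))\<^sup>2"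
      using lower[of "m + t *\<^sub>R h"] by simp
    also have "(norm (m + t *\<^sub>R h))\<^sup>2 = m \<bullet> m + 2 * t * (h \<bullet> m) + t\<^sup>2 * (norm h)\<^sup>2"
      unfolding power2_norm_eq_inner
      by (simp add: inner_add_left inner_add_right inner_commute[of m h] power2_eq_square algebra_simps)
    also have "(m + t *\<^sub>R h) \<bullet> B (m + t *\<^sub>R h) + \<theta> * (m \<bullet> m + 2 * t * (h \<bullet> m) + t\<^sup>2 * (norm h)\<^sup>2)
        = (m \<bullet> B m + \<theta> * (m \<bullet> m)) + 2 * t * (h \<bullet> (B m + \<theta> *\<^sub>R m)) + t\<^sup>2 * p"
      using sym[of m h]
      by (simp add: p_def add scale inner_add_left inner_add_right power2_eq_square algebra_simps)
    also have "m \<bullet> B m + \<theta> * (m \<bullet> m) = 0"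
      using \<theta> n1 by (simp add: dot_square_norm)
    finally show ?thesis by (simp add: power2_norm_eq_inner flip: h_def)
  qed
  \<comment> \<open>Used with t = -q. The 1 in the divisor covers p = 0, and the perturbed value
    becomes -q^2 (p + 2), negative unless q = 0.\<close>
  moreover define q where "q = (norm h)\<^sup>2 / (p + 1)"
  moreover have nh: "(norm h)\<^sup>2 = q * (p + 1)" using p by (simp add: q_def)
  ultimately have "0 \<le> 2 * (- q) * (q * (p + 1)) + (- q)\<^sup>2 * p" by metis
  also have "\<dots> = - (q\<^sup>2 * (p + 2))" by (simp add: power2_eq_square algebra_simps)
  finally have "q\<^sup>2 \<le> 0" using p by (simp add: mult_le_0_iff)
  then have "q = 0" by simp
  then have "h = 0" using nh by simp
  then show "B m = - \<theta> *\<^sub>R m" by (simp add: h_def add_eq_0_iff)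
qed

text \<open>The eigenvector equation, read block by block, gives the two equations. The test vector
  (0, 1) has form value -\<alpha> and yields \<alpha> \<le> \<theta>; test vectors (w, 0) yield the
  curvature bound for H.\<close>

lemma bordered_minimizer:
  fixes H :: "real^'n^'n"
  assumes sym: "\<And>a b. a \<bullet> (H *v b) = b \<bullet> (H *v a)" and "\<alpha> > 0"
    and min: "is_arg_min (\<lambda>w. w \<bullet> bordered_mult H g \<alpha> w) (\<lambda>w. norm w \<le> 1) (u, v)"
  obtains \<theta> where "\<alpha> \<le> \<theta>" "(norm u)\<^sup>2 + v\<^sup>2 = 1"
    "H *v u + v *\<^sub>R g = - \<theta> *\<^sub>R u" "g \<bullet> u = (\<alpha> - \<theta>) * v"
    "\<And>w. w \<bullet> (H *v w) \<ge> - \<theta> * (norm w)\<^sup>2"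
proof -
  let ?B = "bordered_mult H g \<alpha>"
  define \<theta> where "\<theta> = - ((u, v) \<bullet> ?B (u, v))"
  have B: "?B w = (H *v fst w + snd w *\<^sub>R g, g \<bullet> fst w - \<alpha> * snd w)" for w
    by (simp add: bordered_mult_def split_beta)
  have lin: "linear ?B"
    by (rule linearI) (auto simp: B matrix_vector_right_distrib vec.scale inner_add_right algebra_simps scaleR_matrix_vector_assoc)
  have symB: "a \<bullet> ?B b = b \<bullet> ?B a" for a b
    using sym[of "fst a" "fst b"]
    by (simp add: B inner_prod_def inner_add_right inner_diff_right inner_commute algebra_simps)
  have "\<theta> \<ge> - ((0, 1) \<bullet> ?B (0, 1))"
  proof -
    have "norm (0 :: real^'n, 1 :: real) \<le> 1" by (simp add: norm_Pair)
    then show ?thesis using min unfolding is_arg_min_def \<theta>_def by (meson neg_le_iff_le not_le)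
  qed
  then have "\<alpha> \<le> \<theta>" by (simp add: B)
  then have "\<theta> > 0" using assms(2) by simp
  note * = quadratic_form_ball_minimizer[OF lin symB min \<theta>_def this]
  show ?thesis
  proof
    show "\<alpha> \<le> \<theta>" by fact
    show "(norm u)\<^sup>2 + v\<^sup>2 = 1" using *(1) by (simp add: norm_Pair)
    show "H *v u + v *\<^sub>R g = - \<theta> *\<^sub>R u" using *(2) by (simp add: B)
    show "g \<bullet> u = (\<alpha> - \<theta>) * v" using *(2) by (simp add: B algebra_simps)
    show "w \<bullet> (H *v w) \<ge> - \<theta> * (norm w)\<^sup>2" for w
      using *(3)[of "(w, 0)"] by (simp add: B norm_Pair)
  qed
qed

section \<open>Operator norms and negative definite matrices\<close>

lemma norm_matrix_vector_le: "norm (A *v w) \<le> op_norm A * norm w"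
  unfolding op_norm_def by (rule onorm) simp

lemma norm_le_if_op_lipschitz:
  assumes "op_lipschitz C M"
  shows "norm (M z *v w - M z' *v w) \<le> C * dist z z' * norm w"
proof -
  have "norm ((M z - M z') *v w) \<le> op_norm (M z - M z') * norm w" by (rule norm_matrix_vector_le)
  also have "\<dots> \<le> C * dist z z' * norm w"
    using assms by (intro mult_right_mono) (auto simp: op_lipschitz_def)
  finally show ?thesis by (simp add: matrix_vector_mult_diff_rdistrib)
qed

lemma negative_definite_lower_bound:
  fixes M :: "real^'m^'m"
  assumes "w \<bullet> (M *v w) \<le> - \<mu> * (norm w)\<^sup>2" 
  shows "\<mu> * norm w \<le> norm (M *v w)"
proof (cases "w = 0")
  case False
  have "\<mu> * norm w * norm w \<le> - (w \<bullet> (M *v w))" using assms by (simp add: power2_eq_square)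
  also have "\<dots> \<le> norm w * norm (M *v w)"
    using Cauchy_Schwarz_ineq2[of w "M *v w"] by linarith
  finally show ?thesis using False by (simp add: mult.commute)
qed simp

text \<open>\<open>matrix_inv\<close> is a choice, so its laws hold only once invertibility is
  known; this follows from injectivity, which the lower bound on norms provides.\<close>

lemma negative_definite_inverse:
  fixes M :: "real^'m^'m"
  assumes "\<mu> > 0" and "\<And>w. w \<bullet> (M *v w) \<le> - \<mu> * (norm w)\<^sup>2" 
  shows "M *v (matrix_inv M *v w) = w" and "matrix_inv M *v (M *v w) = w"
proof -
  have "w = 0" if "M *v w = 0" for w
    using negative_definite_lower_bound[OF assms(2), of w] that assms(1)
    by (simp add: mult_le_0_iff)
  then have "\<exists>B. B ** M = mat 1" by (simp add: matrix_left_invertible_ker)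
  then have "invertible M" by (simp add: invertible_left_inverse)
  then have "M ** matrix_inv M = mat 1 \<and> matrix_inv M ** M = mat 1"
    unfolding invertible_def matrix_inv_def by (rule someI_ex)
  then show "M *v (matrix_inv M *v w) = w" "matrix_inv M *v (M *v w) = w"
    by (auto simp: matrix_vector_mul_assoc)
qed

section \<open>Taylor bounds\<close>

text \<open>Through this limit of one-sided difference quotients, the next two lemmas pass Lipschitz
  and monotonicity bounds from G to its derivative.\<close>

lemma directional_derivative_limit:
  assumes "(G has_derivative A) (at z)"
  shows "((\<lambda>t. (1 / t) *\<^sub>R (G (z + t *\<^sub>R w) - G z)) \<longlongrightarrow> A w) (at_right 0)"
proof -
  interpret bounded_linear A by (rule has_derivative_bounded_linear[OF assms])
  have "((\<lambda>t. G (z + t *\<^sub>R w)) has_derivative (\<lambda>t. A (t *\<^sub>R w))) (at 0 within {0<..})"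
    by (rule has_derivative_compose[where g = G and f = "\<lambda>t. z + t *\<^sub>R w" and g' = A])
      (auto intro!: derivative_eq_intros assms)
  then have "((\<lambda>t. (1 / norm (t - 0)) *\<^sub>R (G (z + t *\<^sub>R w) - (G (z + 0 *\<^sub>R w) + A ((t - 0) *\<^sub>R w)))) \<longlongrightarrow> 0)
      (at_right 0)"
    unfolding has_derivative_within by blast
  then have "((\<lambda>t. (1 / norm (t - 0)) *\<^sub>R (G (z + t *\<^sub>R w) - (G (z + 0 *\<^sub>R w) + A ((t - 0) *\<^sub>R w))) + A w)
      \<longlongrightarrow> 0 + A w) (at_right 0)"
    by (intro tendsto_intros)
  moreover have "\<forall>\<^sub>F t in at_right 0.
      (1 / norm (t - 0)) *\<^sub>R (G (z + t *\<^sub>R w) - (G (z + 0 *\<^sub>R w) + A ((t - 0) *\<^sub>R w))) + A w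
      = (1 / t) *\<^sub>R (G (z + t *\<^sub>R w) - G z)"
    unfolding eventually_at_right_field
    by (intro exI[of _ 1]) (auto simp: scaleR algebra_simps)
  ultimately show ?thesis by (simp add: filterlim_cong)
qed

lemma norm_derivative_le_if_lipschitz:
  assumes "(G has_derivative A) (at z)" and "\<And>p. norm (G p - G z) \<le> L * norm (p - z)"
  shows "norm (A w) \<le> L * norm w"
proof (rule tendsto_upperbound[OF tendsto_norm[OF directional_derivative_limit[OF assms(1)]]])
  have "norm ((1 / t) *\<^sub>R (G (z + t *\<^sub>R w) - G z)) \<le> L * norm w" if "t > 0" for t
  proof -
    have "norm ((1 / t) *\<^sub>R (G (z + t *\<^sub>R w) - G z)) = norm (G (z + t *\<^sub>R w) - G z) / t"
      using that by (simp only: norm_scaleR) simp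
    also have "\<dots> \<le> L * norm w"
      using assms(2)[of "z + t *\<^sub>R w"] that by (simp add: pos_divide_le_eq mult_ac)
    finally show ?thesis .
  qed
  then show "\<forall>\<^sub>F t in at_right 0. norm ((1 / t) *\<^sub>R (G (z + t *\<^sub>R w) - G z)) \<le> L * norm w"
    unfolding eventually_at_right_field by (meson zero_less_one)
qed simp

lemma inner_derivative_le_if_monotone:
  assumes "(G has_derivative A) (at z)" and "\<And>p. (p - z) \<bullet> (G p - G z) \<le> - \<mu> * (norm (p - z))\<^sup>2"
  shows "w \<bullet> A w \<le> - \<mu> * (norm w)\<^sup>2"
proof (rule tendsto_upperbound[OF tendsto_inner[OF tendsto_const directional_derivative_limit[OF assms(1)]]])
  have "w \<bullet> ((1 / t) *\<^sub>R (G (z + t *\<^sub>R w) - G z)) \<le> - \<mu> * (norm w)\<^sup>2" if "t > 0" for t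
  proof -
    have "t * (w \<bullet> (G (z + t *\<^sub>R w) - G z)) \<le> t * (t * (- \<mu> * (norm w)\<^sup>2))"
      using assms(2)[of "z + t *\<^sub>R w"] by (simp add: power2_eq_square algebra_simps)
    then have "w \<bullet> (G (z + t *\<^sub>R w) - G z) \<le> t * (- \<mu> * (norm w)\<^sup>2)"
      using that by (rule mult_left_le_imp_le)
    then show ?thesis
      using that by (simp only: inner_scaleR_right) (simp add: pos_divide_le_eq mult_ac)
  qed
  then show "\<forall>\<^sub>F t in at_right 0. w \<bullet> ((1 / t) *\<^sub>R (G (z + t *\<^sub>R w) - G z)) \<le> - \<mu> * (norm w)\<^sup>2"
    unfolding eventually_at_right_field by (meson zero_less_one)
qed simp

section \<open>Jacobians and Taylor remainders\<close>

lemma jacobian_eqI: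
  assumes "(G has_derivative (\<lambda>h. M *v h)) (at z)"
  shows "jacobian G z = M"
  unfolding jacobian_def using frechet_derivative_at[OF assms] by (metis matrix_of_matrix_vector_mul)

lemma jacobian_mult:
  fixes G :: "real^'a \<Rightarrow> real^'b"
  assumes "(G has_derivative G') (at z)"
  shows "jacobian G z *v h = G' h"
  unfolding jacobian_def frechet_derivative_at[OF assms, symmetric]
  using has_derivative_linear[OF assms] by (simp add: matrix_works linear_linear)

text \<open>To reduce to a scalar function, the remainder \<open>e\<close> is paired with itself:
  this bounds the square of its norm by its norm times the claimed bound, and one factor
  cancels.\<close>

lemma taylor_gradient:
  fixes G :: "real^'a \<Rightarrow> real^'b"
  assumes "\<And>z. (G has_derivative (\<lambda>h. M z *v h)) (at z)"
    and "\<And>p z w. norm (M p *v w - M z *v w) \<le> C * norm (p - z) * norm w"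
  shows "norm (G (p + d) - G p - M p *v d) \<le> C / 2 * (norm d)\<^sup>2"
proof -
  define e where "e = G (p + d) - G p - M p *v d"
  have "(\<lambda>t. e \<bullet> G (p + t *\<^sub>R d)) 1
      \<le> (\<lambda>t. e \<bullet> G (p + t *\<^sub>R d)) 0 + e \<bullet> (M p *v d) + norm e * (C * (norm d)\<^sup>2) / 2 + 0 / 3"
  proof (rule increment_le_of_deriv_le_quadratic)
    fix t :: real assume t: "0 \<le> t" "t \<le> 1"
    have "((\<lambda>t. G (p + t *\<^sub>R d)) has_derivative (\<lambda>h. M (p + t *\<^sub>R d) *v (h *\<^sub>R d))) (at t)"
      by (rule has_derivative_compose[where g = G and f = "\<lambda>t. p + t *\<^sub>R d"
            and g' = "\<lambda>h. M (p + t *\<^sub>R d) *v h"])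
        (auto intro!: derivative_eq_intros assms)
    then show "((\<lambda>t. e \<bullet> G (p + t *\<^sub>R d)) has_real_derivative e \<bullet> (M (p + t *\<^sub>R d) *v d)) (at t)"
      unfolding has_field_derivative_def
      by (auto intro!: derivative_eq_intros simp: vec.scale matrix_vector_mult_scaleR mult.commute)
    have "e \<bullet> (M (p + t *\<^sub>R d) *v d - M p *v d) \<le> norm e * norm (M (p + t *\<^sub>R d) *v d - M p *v d)"
      by (rule norm_cauchy_schwarz)
    also have "\<dots> \<le> norm e * (C * norm (t *\<^sub>R d) * norm d)"
      using assms(2)[of "p + t *\<^sub>R d" d p] by (intro mult_left_mono) auto
    finally show "e \<bullet> (M (p + t *\<^sub>R d) *v d)
        \<le> e \<bullet> (M p *v d) + norm e * (C * (norm d)\<^sup>2) * t + 0 * t\<^sup>2"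
      using t by (simp add: inner_diff_right power2_eq_square algebra_simps)
  qed
  then have "norm e * norm e \<le> norm e * (C / 2 * (norm d)\<^sup>2)"
    by (simp add: e_def inner_diff_right inner_commute flip: power2_norm_eq_inner power2_eq_square)
      (simp add: power2_norm_eq_inner inner_diff_right inner_diff_left inner_commute)
  \<comment> \<open>For e = 0 nothing can be cancelled and the sign of C is not given; the Lipschitz
    hypothesis between 0 and d supplies it.\<close>
  moreover have "0 \<le> C / 2 * (norm d)\<^sup>2" if "norm e = 0"
  proof (cases "d = 0")
    case False
    have "0 \<le> C * norm (d - 0) * norm d"
      using assms(2)[of d d 0] norm_ge_zero order_trans by blast
    then show ?thesis by (simp add: power2_eq_square mult.assoc)
  qed simp
  ultimately show ?thesis unfolding e_def[symmetric]
    by (metis mult_left_le_imp_le norm_ge_zero order_le_less)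
qed

text \<open>By \<open>taylor_gradient\<close> the derivative along the segment exceeds its affine
  model by at most C/2 t^2 norm d ^ 3; taking the primitive turns 1/2 into 1/6.\<close>

lemma taylor_value:
  fixes F :: "real^'a \<Rightarrow> real"
  assumes F: "\<And>z. GDERIV F z :> G z"
    and G: "\<And>z. (G has_derivative (\<lambda>h. M z *v h)) (at z)"
    and M: "\<And>p z w. norm (M p *v w - M z *v w) \<le> C * norm (p - z) * norm w"
  shows "F (p + d) \<le> F p + G p \<bullet> d + (d \<bullet> (M p *v d)) / 2 + C / 6 * norm d ^ 3"
proof -
  have "(\<lambda>t. F (p + t *\<^sub>R d)) 1
      \<le> (\<lambda>t. F (p + t *\<^sub>R d)) 0 + d \<bullet> G p + (d \<bullet> (M p *v d)) / 2 + C / 2 * norm d ^ 3 / 3"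
  proof (rule increment_le_of_deriv_le_quadratic)
    fix t :: real assume t: "0 \<le> t" "t \<le> 1"
    show "((\<lambda>t. F (p + t *\<^sub>R d)) has_real_derivative d \<bullet> G (p + t *\<^sub>R d)) (at t)"
      by (intro GDERIV_along_line F)
    have "d \<bullet> (G (p + t *\<^sub>R d) - G p - M p *v (t *\<^sub>R d))
        \<le> norm d * norm (G (p + t *\<^sub>R d) - G p - M p *v (t *\<^sub>R d))"
      by (rule norm_cauchy_schwarz)
    also have "\<dots> \<le> norm d * (C / 2 * (norm (t *\<^sub>R d))\<^sup>2)"
      by (intro mult_left_mono taylor_gradient G M) simp
    finally show "d \<bullet> G (p + t *\<^sub>R d)
        \<le> d \<bullet> G p + (d \<bullet> (M p *v d)) * t + C / 2 * norm d ^ 3 * t\<^sup>2"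
      using t by (simp add: inner_diff_right matrix_vector_mult_scaleR power2_eq_square
          power3_eq_cube algebra_simps)
  qed
  then show ?thesis by (simp add: inner_commute)
qed

section \<open>The value function of the minimax problem\<close>

text \<open>Collects assumptions (1) to (3). The lower bound of the value function stays outside
  because it enters only in counting iterations.\<close>

locale smooth_minimax =
  fixes f :: "(real^'n) \<times> (real^'m) \<Rightarrow> real" and \<mu> l1 l2 :: real
  assumes twice: "twice_differentiable f"
    and mu_pos: "\<mu> > 0"
    and strong: "\<And>x. strongly_concave \<mu> (\<lambda>y. f (x, y))"
    and lipschitz: "l1-lipschitz_on UNIV (gradient f)"
    and lipschitz_xx: "op_lipschitz l2 (hess_xx f)"
    and lipschitz_xy: "op_lipschitz l2 (hess_xy f)"
    and lipschitz_yx: "op_lipschitz l2 (hess_yx f)"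
    and lipschitz_yy: "op_lipschitz l2 (hess_yy f)"
begin

section \<open>Partial gradients and the block Hessian\<close>

lemma GDERIV_f: "GDERIV f z :> gradient f z"
  using twice unfolding twice_differentiable_def by (intro GDERIV_gradient) blast

lemma GDERIV_x: "GDERIV (\<lambda>x'. f (x', y)) x :> fst (gradient f (x, y))"
proof -
  have "((\<lambda>x'. f (x', y)) has_derivative (\<lambda>h. (h, 0) \<bullet> gradient f (x, y))) (at x)"
    by (rule has_derivative_compose[where g = f and f = "\<lambda>x'. (x', y)"
          and g' = "\<lambda>h. h \<bullet> gradient f (x, y)"])
      (auto intro!: derivative_eq_intros GDERIV_f[unfolded gderiv_def])
  then show ?thesis by (simp add: gderiv_def inner_prod_def)
qed

lemma GDERIV_y: "GDERIV (\<lambda>y'. f (x, y')) y :> snd (gradient f (x, y))"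
proof -
  have "((\<lambda>y'. f (x, y')) has_derivative (\<lambda>h. (0, h) \<bullet> gradient f (x, y))) (at y)"
    by (rule has_derivative_compose[where g = f and f = "\<lambda>y'. (x, y')"
          and g' = "\<lambda>h. h \<bullet> gradient f (x, y)"])
      (auto intro!: derivative_eq_intros GDERIV_f[unfolded gderiv_def])
  then show ?thesis by (simp add: gderiv_def inner_prod_def)
qed

lemma grad_x_eq: "grad_x f z = fst (gradient f z)"
  using gradient_eqI[OF GDERIV_x] by (simp add: grad_x_def split_beta)

lemma grad_y_eq: "grad_y f z = snd (gradient f z)"
  using gradient_eqI[OF GDERIV_y] by (simp add: grad_y_def split_beta)

lemma gradient_lipschitz: "norm (gradient f p - gradient f q) \<le> l1 * norm (p - q)"
  using lipschitz_onD[OF lipschitz] by (simp add: dist_norm)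

lemma l1_nonneg: "0 \<le> l1"
  using lipschitz by (simp add: lipschitz_on_def)

lemma grad_x_lipschitz: "norm (grad_x f p - grad_x f q) \<le> l1 * norm (p - q)"
  using gradient_lipschitz[of p q]
    norm_fst_le[of "fst (gradient f p - gradient f q)" "snd (gradient f p - gradient f q)"]
  unfolding prod.collapse unfolding grad_x_eq fst_diff by linarith

lemma grad_y_lipschitz: "norm (grad_y f p - grad_y f q) \<le> l1 * norm (p - q)"
  using gradient_lipschitz[of p q]
    norm_snd_le[of "snd (gradient f p - gradient f q)" "fst (gradient f p - gradient f q)"]
  unfolding prod.collapse unfolding grad_y_eq snd_diff by linarith

text \<open>The blocks are defined by partial differentiation; total differentiability of the
  gradient makes them restrictions of one linear map to the coordinate subspaces, so they add up to
  it.\<close>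

lemma gradient_has_derivative:
  "(gradient f has_derivative (\<lambda>w. (hess_xx f z *v fst w + hess_xy f z *v snd w,
      hess_yx f z *v fst w + hess_yy f z *v snd w))) (at z)"
proof -
  obtain x y where z: "z = (x, y)" by fastforce
  obtain D where D: "(gradient f has_derivative D) (at z)"
    using twice unfolding twice_differentiable_def differentiable_def by blast
  interpret bounded_linear D by (rule has_derivative_bounded_linear[OF D])
  have x: "((\<lambda>x'. gradient f (x', y)) has_derivative (\<lambda>h. D (h, 0))) (at x)"
    by (rule has_derivative_compose[where g = "gradient f" and f = "\<lambda>x'. (x', y)" and g' = D])
      (use D z in \<open>auto intro!: derivative_eq_intros\<close>)
  have y: "((\<lambda>y'. gradient f (x, y')) has_derivative (\<lambda>h. D (0, h))) (at y)"
    by (rule has_derivative_compose[where g = "gradient f" and f = "\<lambda>y'. (x, y')" and g' = D])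
      (use D z in \<open>auto intro!: derivative_eq_intros\<close>)
  have blocks: "hess_xx f z *v h = fst (D (h, 0))" "hess_yx f z *v h = snd (D (h, 0))"
    "hess_xy f z *v k = fst (D (0, k))" "hess_yy f z *v k = snd (D (0, k))" for h k
    using jacobian_mult[OF has_derivative_fst[OF x]] jacobian_mult[OF has_derivative_snd[OF x]]
      jacobian_mult[OF has_derivative_fst[OF y]] jacobian_mult[OF has_derivative_snd[OF y]]
    by (simp_all add: z hess_xx_def hess_xy_def hess_yx_def hess_yy_def grad_x_eq grad_y_eq)
  have "D w = (hess_xx f z *v fst w + hess_xy f z *v snd w,
      hess_yx f z *v fst w + hess_yy f z *v snd w)" for w
    using add[of "(fst w, 0)" "(0, snd w)"] by (simp add: blocks prod_eq_iff)
  then show ?thesis using D by (metis (no_types, lifting) ext)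
qed

lemma hess_symmetric:
  "a \<bullet> (hess_xx f z *v b) = b \<bullet> (hess_xx f z *v a)"
  "k \<bullet> (hess_yy f z *v l) = l \<bullet> (hess_yy f z *v k)"
  "a \<bullet> (hess_xy f z *v k) = k \<bullet> (hess_yx f z *v a)"
  using derivative_of_gradient_symmetric[OF GDERIV_f gradient_has_derivative, of "(a, 0)" z "(b, 0)"]
    derivative_of_gradient_symmetric[OF GDERIV_f gradient_has_derivative, of "(0, k)" z "(0, l)"]
    derivative_of_gradient_symmetric[OF GDERIV_f gradient_has_derivative, of "(a, 0)" z "(0, k)"]
  by (simp_all add: inner_prod_def)

lemma hess_bounded:
  "norm (hess_xx f z *v a) \<le> l1 * norm a" "norm (hess_yx f z *v a) \<le> l1 * norm a"
  "norm (hess_xy f z *v k) \<le> l1 * norm k"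
proof -
  note le = norm_derivative_le_if_lipschitz[OF gradient_has_derivative gradient_lipschitz, of z]
  show "norm (hess_xx f z *v a) \<le> l1 * norm a" "norm (hess_yx f z *v a) \<le> l1 * norm a"
    using order_trans[OF norm_fst_le le[of "(a, 0)"]] order_trans[OF norm_snd_le le[of "(a, 0)"]]
    by simp_all
  show "norm (hess_xy f z *v k) \<le> l1 * norm k"
    using order_trans[OF norm_fst_le le[of "(0, k)"]] by simp
qed

section \<open>Strong concavity in the second variable\<close>

lemma upper_bound_y:
  "f (x, b) \<le> f (x, a) + grad_y f (x, a) \<bullet> (b - a) - \<mu> / 2 * (norm (b - a))\<^sup>2"
  using strongly_concave_upper_bound[OF strong GDERIV_y] by (simp add: grad_y_eq)

lemma lower_bound_y:
  "f (x, b) \<ge> f (x, a) + grad_y f (x, a) \<bullet> (b - a) - l1 / 2 * (norm (b - a))\<^sup>2"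
proof (rule lipschitz_gradient_lower_bound)
  show "GDERIV (\<lambda>y'. f (x, y')) y :> grad_y f (x, y)" for y
    using GDERIV_y by (simp add: grad_y_eq)
  show "norm (grad_y f (x, p) - grad_y f (x, q)) \<le> l1 * norm (p - q)" for p q
    using grad_y_lipschitz[of "(x, p)" "(x, q)"] by (simp add: norm_Pair)
qed

text \<open>Adding the concavity bounds with \<open>a\<close> and \<open>b\<close> exchanged cancels
  the values of f.\<close>

lemma grad_y_monotone:
  "(b - a) \<bullet> (grad_y f (x, b) - grad_y f (x, a)) \<le> - \<mu> * (norm (b - a))\<^sup>2"
  using upper_bound_y[of x b a] upper_bound_y[of x a b]
  by (simp add: inner_diff_right inner_diff_left inner_commute norm_minus_commute)

lemma hess_yy_negative: "k \<bullet> (hess_yy f z *v k) \<le> - \<mu> * (norm k)\<^sup>2"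
proof -
  obtain x y where z: "z = (x, y)" by fastforce
  have "((\<lambda>y'. gradient f (x, y')) has_derivative
      (\<lambda>h. (hess_xy f z *v h, hess_yy f z *v h))) (at y)"
    by (rule has_derivative_compose[where g = "gradient f" and f = "\<lambda>y'. (x, y')",
          OF _ gradient_has_derivative, THEN has_derivative_eq_rhs])
      (auto simp: z intro!: derivative_eq_intros)
  then have "((\<lambda>y'. grad_y f (x, y')) has_derivative (\<lambda>h. hess_yy f z *v h)) (at y)"
    unfolding grad_y_eq by (auto dest: has_derivative_snd)
  then show ?thesis by (rule inner_derivative_le_if_monotone) (rule grad_y_monotone)
qed

lemma hess_yy_lower: "\<mu> * norm k \<le> norm (hess_yy f z *v k)"
  by (rule negative_definite_lower_bound[OF hess_yy_negative])

lemma hess_yy_inverse: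
  "hess_yy f z *v (matrix_inv (hess_yy f z) *v k) = k"
  "matrix_inv (hess_yy f z) *v (hess_yy f z *v k) = k"
  using negative_definite_inverse[OF mu_pos hess_yy_negative] by auto

text \<open>Strong monotonicity and the Lipschitz bound are compared along one unit vector, which
  exists because index types are nonempty.\<close>

lemma mu_le_l1: "\<mu> \<le> l1"
proof -
  let ?e = "axis undefined 1 :: real^'m"
  have "- (?e \<bullet> (grad_y f (0, ?e) - grad_y f (0, 0))) \<ge> \<mu> * (norm ?e)\<^sup>2"
    using grad_y_monotone[of ?e 0 0] by simp
  moreover have "- (?e \<bullet> (grad_y f (0, ?e) - grad_y f (0, 0))) \<le> norm ?e * norm (grad_y f (0, ?e) - grad_y f (0, 0))"
    using Cauchy_Schwarz_ineq2[of ?e "grad_y f (0, ?e) - grad_y f (0, 0)"] by linarith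
  moreover have "norm (grad_y f (0, ?e) - grad_y f (0, 0)) \<le> l1 * norm ?e"
    using grad_y_lipschitz[of "(0, ?e)" "(0, 0)"] by (simp add: norm_Pair)
  ultimately show ?thesis by (simp add: norm_axis_1)
qed

lemma l1_pos: "0 < l1"
  using mu_pos mu_le_l1 by simp

section \<open>The maximizer: existence, Lipschitz constant and derivative\<close>

abbreviation "\<kappa> \<equiv> l1 / \<mu>"

lemma kappa_ge_1: "1 \<le> \<kappa>"
  using mu_pos mu_le_l1 by simp

text \<open>\<open>arg_max\<close> is a choice, so this property rests on the existence of some
  maximizer.\<close>

lemma y_star_max: "f (x, y) \<le> f (x, y_star f x)"
proof -
  have "\<exists>y. \<forall>y'. f (x, y') \<le> f (x, y)"
    by (rule strongly_concave_max_exists[OF strong mu_pos])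
      (use GDERIV_y in \<open>auto simp: gderiv_def differentiable_def\<close>)
  then obtain y0 where "\<forall>y'. f (x, y') \<le> f (x, y0)" by blast
  then have "is_arg_max (\<lambda>y. f (x, y)) (\<lambda>_. True) y0"
    by (simp add: is_arg_max_def not_less)
  then have "is_arg_max (\<lambda>y. f (x, y)) (\<lambda>_. True) (y_star f x)"
    unfolding y_star_def arg_max_def by (rule someI)
  then show ?thesis by (simp add: is_arg_max_def not_less)
qed

lemma max_value_eq: "max_value f x = f (x, y_star f x)"
  unfolding max_value_def by (rule cSup_eq_maximum) (auto intro: y_star_max)

lemma grad_y_y_star: "grad_y f (x, y_star f x) = 0"
  unfolding grad_y_eq using gradient_zero_at_max[OF GDERIV_y y_star_max] by simp

text \<open>The mixed point (a, \<open>y_star f b\<close>) links the two: its y-gradient is at least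
  \<mu> times the distance of the maximizers, seen from a, and at most l1 times the distance of a
  and b, seen from b.\<close>

lemma y_star_lipschitz: "norm (y_star f a - y_star f b) \<le> \<kappa> * norm (a - b)"
proof -
  let ?d = "y_star f a - y_star f b"
  let ?g = "grad_y f (a, y_star f b)"
  have "\<mu> * (norm ?d)\<^sup>2 \<le> ?d \<bullet> ?g"
    using grad_y_monotone[of "y_star f a" "y_star f b" a] by (simp add: grad_y_y_star)
  also have "\<dots> \<le> norm ?d * norm ?g" by (rule norm_cauchy_schwarz)
  also have "norm ?g \<le> l1 * norm (a - b)"
    using grad_y_lipschitz[of "(a, y_star f b)" "(b, y_star f b)"]
    by (simp add: grad_y_y_star norm_Pair)
  then have "norm ?d * norm ?g \<le> norm ?d * (l1 * norm (a - b))" by (rule mult_left_mono) simp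
  finally have "norm ?d * (\<mu> * norm ?d) \<le> norm ?d * (l1 * norm (a - b))"
    by (simp add: power2_eq_square mult_ac)
  then have "\<mu> * norm ?d \<le> l1 * norm (a - b)"
    using l1_nonneg by (cases "norm ?d = 0") (auto simp: mult_le_cancel_left)
  then show ?thesis using mu_pos by (simp add: field_simps)
qed

lemma graph_lipschitz:
  "norm ((a, y_star f a) - (b, y_star f b)) \<le> (1 + \<kappa>) * norm (a - b)"
proof -
  have "norm ((a, y_star f a) - (b, y_star f b)) \<le> norm (a - b) + norm (y_star f a - y_star f b)"
    using norm_Pair_le[of "a - b" "y_star f a - y_star f b"] by simp
  also have "\<dots> \<le> norm (a - b) + \<kappa> * norm (a - b)" using y_star_lipschitz by simp
  finally show ?thesis by (simp add: distrib_right)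
qed

text \<open>Implicit differentiation by hand: \<open>grad_y f\<close> vanishes at both ends of an
  increment along the graph, so its linearization there is pure remainder. The Lipschitz graph makes
  this small relative to x' - x, and \<open>hess_yy_lower\<close> transfers the bound to
  \<open>y_star\<close>.\<close>

lemma y_star_has_derivative:
  fixes x :: "real^'n"
  defines "z \<equiv> (x, y_star f x)"
  shows "(y_star f has_derivative (\<lambda>h. - (matrix_inv (hess_yy f z) *v (hess_yx f z *v h)))) (at x)"
  unfolding has_derivative_at_alt
proof (intro conjI allI impI)
  show "bounded_linear (\<lambda>h. - (matrix_inv (hess_yy f z) *v (hess_yx f z *v h)))"
    by (intro bounded_linear_minus bounded_linear_compose[OF matrix_vector_mul_bounded_linear]
        matrix_vector_mul_bounded_linear)
  fix e :: real assume e: "e > 0"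
  let ?K = "1 + \<kappa>"
  have K: "?K > 0" using kappa_ge_1 by simp
  \<comment> \<open>In this tolerance the divisor pays for the Lipschitz constant of the graph and
    \<mu> for inverting \<open>hess_yy\<close>.\<close>
  have "e * \<mu> / ?K > 0" using e K mu_pos by simp
  then obtain d where d: "d > 0" "\<And>w. norm (w - z) < d \<Longrightarrow>
      norm (gradient f w - gradient f z - (hess_xx f z *v fst (w - z) + hess_xy f z *v snd (w - z),
      hess_yx f z *v fst (w - z) + hess_yy f z *v snd (w - z))) \<le> e * \<mu> / ?K * norm (w - z)"
    using gradient_has_derivative[of z] unfolding has_derivative_at_alt by meson
  show "\<exists>d>0. \<forall>x'. norm (x' - x) < d \<longrightarrow>
      norm (y_star f x' - y_star f x - - (matrix_inv (hess_yy f z) *v (hess_yx f z *v (x' - x))))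
        \<le> e * norm (x' - x)"
  proof (intro exI[of _ "d / ?K"] conjI allI impI)
    show "d / ?K > 0" using d(1) K by simp
    fix x' assume x': "norm (x' - x) < d / ?K"
    define w where "w = (x', y_star f x')"
    have wz: "norm (w - z) \<le> ?K * norm (x' - x)"
      unfolding w_def z_def by (rule graph_lipschitz)
    also have "\<dots> < d" using x' K by (simp add: pos_less_divide_eq mult.commute)
    finally have "norm (w - z) < d" .
    from d(2)[OF this] have
      "norm (snd (gradient f w - gradient f z - (hess_xx f z *v fst (w - z) + hess_xy f z *v snd (w - z),
      hess_yx f z *v fst (w - z) + hess_yy f z *v snd (w - z)))) \<le> e * \<mu> / ?K * norm (w - z)"
      by (rule order_trans[rotated]) (metis norm_snd_le prod.collapse)
    also have "\<dots> \<le> e * \<mu> / ?K * (?K * norm (x' - x))"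
      using wz e mu_pos K by (intro mult_left_mono) auto
    also have "\<dots> = e * \<mu> * norm (x' - x)" using K by simp
    finally have 1: "norm (hess_yx f z *v (x' - x) + hess_yy f z *v (y_star f x' - y_star f x))
        \<le> e * \<mu> * norm (x' - x)"
      using grad_y_y_star[of x'] grad_y_y_star[of x]
      by (simp add: w_def z_def grad_y_eq norm_minus_commute flip: minus_add_distrib)
    let ?r = "y_star f x' - y_star f x - - (matrix_inv (hess_yy f z) *v (hess_yx f z *v (x' - x)))"
    have "\<mu> * norm ?r \<le> norm (hess_yy f z *v ?r)" by (rule hess_yy_lower)
    also have "hess_yy f z *v ?r = hess_yx f z *v (x' - x) + hess_yy f z *v (y_star f x' - y_star f x)"
      by (simp add: matrix_vector_right_distrib hess_yy_inverse)
    finally have "\<mu> * norm ?r \<le> \<mu> * (e * norm (x' - x))" using 1 by (simp add: mult_ac)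
    then show "norm ?r \<le> e * norm (x' - x)" using mu_pos by (rule mult_left_le_imp_le)
  qed
qed

section \<open>Gradient and Hessian of the value function\<close>

lemma graph_has_derivative:
  fixes x :: "real^'n"
  defines "z \<equiv> (x, y_star f x)"
  shows "((\<lambda>x. (x, y_star f x)) has_derivative
    (\<lambda>h. (h, - (matrix_inv (hess_yy f z) *v (hess_yx f z *v h))))) (at x)"
  unfolding z_def by (intro has_derivative_Pair has_derivative_ident y_star_has_derivative)

lemma GDERIV_max_value: "GDERIV (max_value f) x :> grad_x f (x, y_star f x)"
proof -
  let ?z = "(x, y_star f x)"
  have "((\<lambda>x. f (x, y_star f x)) has_derivative
      (\<lambda>h. (h, - (matrix_inv (hess_yy f ?z) *v (hess_yx f ?z *v h))) \<bullet> gradient f ?z)) (at x)"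
    by (rule has_derivative_compose[where g = f and f = "\<lambda>x. (x, y_star f x)"
          and g' = "\<lambda>h. h \<bullet> gradient f ?z", OF graph_has_derivative])
      (rule GDERIV_f[unfolded gderiv_def])
  moreover have "snd (gradient f ?z) = 0" using grad_y_y_star grad_y_eq by metis
  ultimately show ?thesis
    by (simp add: gderiv_def inner_prod_def grad_x_eq max_value_eq[abs_def])
qed

lemma gradient_max_value: "gradient (max_value f) x = grad_x f (x, y_star f x)"
  by (rule gradient_eqI[OF GDERIV_max_value])

section \<open>The Schur complement at arbitrary points\<close>

lemma schur_H_mult:
  "schur_H f z *v h = hess_xx f z *v h
    - hess_xy f z *v (matrix_inv (hess_yy f z) *v (hess_yx f z *v h))"
  by (simp add: schur_H_def matrix_vector_mult_diff_rdistrib flip: matrix_vector_mul_assoc)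

lemma gradient_max_value_has_derivative:
  "(gradient (max_value f) has_derivative (\<lambda>h. schur_H f (x, y_star f x) *v h)) (at x)"
proof -
  let ?z = "(x, y_star f x)"
  have "((\<lambda>x. gradient f (x, y_star f x)) has_derivative
      (\<lambda>h. (hess_xx f ?z *v h + hess_xy f ?z *v (- (matrix_inv (hess_yy f ?z) *v (hess_yx f ?z *v h))),
        hess_yx f ?z *v h + hess_yy f ?z *v (- (matrix_inv (hess_yy f ?z) *v (hess_yx f ?z *v h)))))) (at x)"
    using has_derivative_compose[where g = "gradient f", OF graph_has_derivative gradient_has_derivative]
    by simp
  from has_derivative_fst[OF this] show ?thesis
    by (simp add: gradient_max_value[abs_def] grad_x_eq schur_H_mult vec.neg)
qed

lemma hessian_max_value: "hessian (max_value f) x = schur_H f (x, y_star f x)"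
  unfolding hessian_def by (rule jacobian_eqI[OF gradient_max_value_has_derivative])

text \<open>By the two-sided inverse, the correction term is the symmetric form of
  \<open>hess_yy\<close> evaluated at the solutions ?p a and ?p b.\<close>

lemma schur_H_symmetric: "a \<bullet> (schur_H f z *v b) = b \<bullet> (schur_H f z *v a)"
proof -
  let ?Y = "hess_yy f z" and ?p = "\<lambda>w. matrix_inv (hess_yy f z) *v (hess_yx f z *v w)"
  have "a \<bullet> (hess_xy f z *v ?p b) = ?p b \<bullet> (?Y *v ?p a)" for a b
    by (simp add: hess_symmetric(3) hess_yy_inverse)
  then have "a \<bullet> (hess_xy f z *v ?p b) = b \<bullet> (hess_xy f z *v ?p a)"
    using hess_symmetric(2) by metis
  then show ?thesis
    using hess_symmetric(1)[of a z b] by (simp add: schur_H_mult inner_diff_right)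
qed

lemma norm_schur_solution:
  "norm (matrix_inv (hess_yy f z) *v (hess_yx f z *v w)) \<le> \<kappa> * norm w"
proof -
  have "\<mu> * norm (matrix_inv (hess_yy f z) *v (hess_yx f z *v w)) \<le> norm (hess_yx f z *v w)"
    using hess_yy_lower[of "matrix_inv (hess_yy f z) *v (hess_yx f z *v w)" z]
    by (simp add: hess_yy_inverse)
  also have "\<dots> \<le> l1 * norm w" by (rule hess_bounded)
  finally show ?thesis using mu_pos by (simp add: field_simps)
qed

lemma schur_H_bounded: "norm (schur_H f z *v w) \<le> (\<kappa> + 1) * l1 * norm w"
proof -
  let ?p = "matrix_inv (hess_yy f z) *v (hess_yx f z *v w)"
  have "norm (schur_H f z *v w) \<le> norm (hess_xx f z *v w) + norm (hess_xy f z *v ?p)"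
    unfolding schur_H_mult by (rule norm_triangle_ineq4)
  also have "\<dots> \<le> l1 * norm w + l1 * norm ?p" by (intro add_mono hess_bounded)
  also have "\<dots> \<le> l1 * norm w + l1 * (\<kappa> * norm w)"
    using norm_schur_solution l1_nonneg by (intro add_left_mono mult_left_mono) auto
  finally show ?thesis by (simp add: algebra_simps)
qed

text \<open>Instead of subtracting inverse matrices, the solutions p and p' of the two linear
  systems are compared by applying \<open>hess_yy\<close> at z'. In units of e the contributions are
  1, \<kappa> and \<kappa> (1 + \<kappa>), which add up to (1 + \<kappa>)^2.\<close>

lemma schur_H_lipschitz:
  "norm (schur_H f z *v w - schur_H f z' *v w) \<le> l2 * (1 + \<kappa>)\<^sup>2 * norm (z - z') * norm w"
proof -
  define p p' where "p = matrix_inv (hess_yy f z) *v (hess_yx f z *v w)"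
    and "p' = matrix_inv (hess_yy f z') *v (hess_yx f z' *v w)"
  define e where "e = l2 * norm (z - z') * norm w"
  note lips = lipschitz_xx[THEN norm_le_if_op_lipschitz] lipschitz_xy[THEN norm_le_if_op_lipschitz]
    lipschitz_yx[THEN norm_le_if_op_lipschitz] lipschitz_yy[THEN norm_le_if_op_lipschitz]
  have l2: "0 \<le> l2 * norm (z - z')"
  proof -
    have "0 \<le> op_norm (hess_xx f z - hess_xx f z')"
      unfolding op_norm_def by (rule onorm_pos_le) simp
    also have "\<dots> \<le> l2 * norm (z - z')"
      using lipschitz_xx unfolding op_lipschitz_def dist_norm by blast
    finally show ?thesis .
  qed
  have k0: "0 \<le> \<kappa>" using kappa_ge_1 by simp
  have p: "norm p \<le> \<kappa> * norm w" unfolding p_def by (rule norm_schur_solution)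
  have e: "l2 * norm (z - z') * norm p \<le> \<kappa> * e"
    using mult_left_mono[OF p l2] by (simp add: e_def mult_ac)
  have "\<mu> * norm (p - p') \<le> norm (hess_yy f z' *v (p - p'))" by (rule hess_yy_lower)
  also have "hess_yy f z' *v (p - p') = (hess_yx f z *v w - hess_yx f z' *v w)
      - (hess_yy f z *v p - hess_yy f z' *v p)"
    by (simp add: matrix_vector_mult_diff_distrib p_def p'_def hess_yy_inverse)
  also have "norm \<dots> \<le> norm (hess_yx f z *v w - hess_yx f z' *v w)
      + norm (hess_yy f z *v p - hess_yy f z' *v p)"
    by (rule norm_triangle_ineq4)
  also have "\<dots> \<le> e + \<kappa> * e"
    using lips(3)[of z w z'] lips(4)[of z p z'] e by (simp add: e_def dist_norm)
  finally have pp: "\<mu> * norm (p - p') \<le> (1 + \<kappa>) * e" by (simp add: distrib_right)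
  have "l1 * norm (p - p') = \<kappa> * (\<mu> * norm (p - p'))" using mu_pos by simp
  also have "\<dots> \<le> \<kappa> * ((1 + \<kappa>) * e)" using pp k0 by (rule mult_left_mono)
  finally have lpp: "l1 * norm (p - p') \<le> \<kappa> * ((1 + \<kappa>) * e)" .
  have "schur_H f z *v w - schur_H f z' *v w = (hess_xx f z *v w - hess_xx f z' *v w)
      - (hess_xy f z *v p - hess_xy f z' *v p) - hess_xy f z' *v (p - p')"
    by (simp add: schur_H_mult p_def p'_def matrix_vector_mult_diff_distrib)
  also have "norm \<dots> \<le> norm (hess_xx f z *v w - hess_xx f z' *v w)
      + norm (hess_xy f z *v p - hess_xy f z' *v p) + norm (hess_xy f z' *v (p - p'))"
    by (intro order_trans[OF norm_triangle_ineq4] add_right_mono norm_triangle_ineq4)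
  also have "\<dots> \<le> e + \<kappa> * e + \<kappa> * ((1 + \<kappa>) * e)"
    using lips(1)[of z w z'] lips(2)[of z p z'] e lpp hess_bounded(3)[of z' "p - p'"]
    by (simp add: e_def dist_norm)
  also have "\<dots> = (1 + \<kappa>)\<^sup>2 * e"
    by (simp add: power2_eq_square add_divide_distrib algebra_simps)
  finally show ?thesis by (simp add: e_def mult_ac)
qed

lemma schur_H_graph_lipschitz:
  assumes "0 \<le> l2"
  shows "norm (schur_H f (a, y_star f a) *v w - schur_H f (b, y_star f b) *v w)
    \<le> l2 * (1 + \<kappa>) ^ 3 * norm (a - b) * norm w"
proof -
  let ?z = "(a, y_star f a)" and ?z' = "(b, y_star f b)"
  have "norm (schur_H f ?z *v w - schur_H f ?z' *v w)
      \<le> l2 * (1 + \<kappa>)\<^sup>2 * norm (?z - ?z') * norm w" by (rule schur_H_lipschitz)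
  also have "\<dots> \<le> l2 * (1 + \<kappa>)\<^sup>2 * ((1 + \<kappa>) * norm (a - b)) * norm w"
    using assms graph_lipschitz by (intro mult_right_mono mult_left_mono) auto
  finally show ?thesis by (simp add: power2_eq_square power3_eq_cube mult_ac)
qed

lemma inner_loop_accuracy:
  assumes "norm (y0 - y_star f x) \<le> r" and "0 < A"
    and "2 * sqrt \<kappa> * ln (sqrt (\<kappa> + 1) * r / A) \<le> real N"
  shows "norm (fst (accel_ascent (\<lambda>z. grad_y f (x, z)) (1 / l1)
      ((sqrt \<kappa> - 1) / (sqrt \<kappa> + 1)) y0 N) - y_star f x) \<le> A"
  by (rule accel_ascent_accuracy[where F = "\<lambda>y. f (x, y)" and \<mu> = \<mu>])
    (use assms upper_bound_y lower_bound_y mu_pos mu_le_l1 grad_y_y_star in auto)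

end

section \<open>One outer iteration\<close>

text \<open>The exact model of one iteration, detached from f. The equations for u, v and \<theta>
  are those delivered by \<open>bordered_minimizer\<close>, where -\<theta> is the least eigenvalue
  of the bordered matrix.\<close>

locale hsda_step =
  fixes H :: "real^'n^'n" and g u s :: "real^'n" and v \<theta> \<alpha> \<omega> \<Lambda> :: real
  assumes alpha: "0 < \<alpha>" "\<alpha> \<le> \<theta>"
    and radius: "0 < \<Lambda>" "\<Lambda>\<^sup>2 \<le> 1 / 2"
    and threshold: "0 < \<omega>" "\<omega> < 1 / 2"
    and unit: "(norm u)\<^sup>2 + v\<^sup>2 = 1"
    and stationary_u: "H *v u + v *\<^sub>R g = - \<theta> *\<^sub>R u"
    and stationary_v: "g \<bullet> u = (\<alpha> - \<theta>) * v"
    and direction: "s = (if \<bar>v\<bar> \<ge> \<omega> then u /\<^sub>R v else sgn1 (- (g \<bullet> u)) *\<^sub>R u)"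
begin

text \<open>On the unit sphere the termination test says that u / v is shorter than
  \<Lambda>.\<close>

lemma stop_iff: "\<bar>v\<bar> > sqrt (1 / (1 + \<Lambda>\<^sup>2)) \<longleftrightarrow> (norm u)\<^sup>2 < \<Lambda>\<^sup>2 * v\<^sup>2"
proof -
  have "\<bar>v\<bar> > sqrt (1 / (1 + \<Lambda>\<^sup>2)) \<longleftrightarrow> v\<^sup>2 > 1 / (1 + \<Lambda>\<^sup>2)"
    by (metis real_sqrt_abs real_sqrt_less_iff)
  also have "\<dots> \<longleftrightarrow> v\<^sup>2 * (1 + \<Lambda>\<^sup>2) > 1"
    using radius by (simp add: pos_divide_less_eq add_pos_pos)
  also have "\<dots> \<longleftrightarrow> (norm u)\<^sup>2 < \<Lambda>\<^sup>2 * v\<^sup>2"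
    using unit by (simp add: algebra_simps) linarith
  finally show ?thesis .
qed

lemma curvature_u: "u \<bullet> (H *v u) = - \<theta> * (norm u)\<^sup>2 + (\<theta> - \<alpha>) * v\<^sup>2"
proof -
  have "H *v u = - \<theta> *\<^sub>R u - v *\<^sub>R g" using stationary_u by (simp add: eq_diff_eq)
  then have "u \<bullet> (H *v u) = - \<theta> * (norm u)\<^sup>2 - v * (g \<bullet> u)"
    by (simp add: inner_diff_right inner_commute power2_norm_eq_inner)
  then show ?thesis by (simp add: stationary_v power2_eq_square algebra_simps)
qed

text \<open>In both branches s is at least \<Lambda> long, so \<tau> \<le> 1. The terms carrying
  \<theta> - \<alpha> have a favourable sum: the linear one is a decrease, and the curvature term is
  of second order in \<tau>, or in \<tau> \<bar>v\<bar>, which is at most 1. What remains is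
  -\<theta> \<Lambda>^2 / 2.\<close>

lemma model_decrease:
  assumes "\<not> \<bar>v\<bar> > sqrt (1 / (1 + \<Lambda>\<^sup>2))"
  defines "d \<equiv> (\<Lambda> / norm s) *\<^sub>R s"
  shows "norm d = \<Lambda>" and "g \<bullet> d + (d \<bullet> (H *v d)) / 2 \<le> - \<alpha> * \<Lambda>\<^sup>2 / 2"
proof -
  define \<tau> where "\<tau> = \<Lambda> / norm s"
  have uv: "\<Lambda>\<^sup>2 * v\<^sup>2 \<le> (norm u)\<^sup>2" using assms(1) stop_iff by simp
  have "u \<noteq> 0"
  proof
    assume "u = 0"
    with uv radius have "v = 0" by (simp add: mult_le_0_iff)
    with \<open>u = 0\<close> unit show False by simp
  qed
  have \<tau>s: "0 < norm s \<and> \<tau> \<le> 1 \<and>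
      \<tau> * (g \<bullet> s) + \<tau>\<^sup>2 / 2 * (s \<bullet> (H *v s)) \<le> - \<theta> * (\<tau> * norm s)\<^sup>2 / 2"
  proof (cases "\<bar>v\<bar> \<ge> \<omega>")
    case True
    then have v: "v \<noteq> 0" using threshold by auto
    have s: "s = (1 / v) *\<^sub>R u" using True direction by (simp add: divide_inverse)
    have ns: "norm s = norm u / \<bar>v\<bar>" by (simp add: s)
    then have spos: "0 < norm s" using v \<open>u \<noteq> 0\<close> by simp
    have "(\<Lambda> * \<bar>v\<bar>)\<^sup>2 \<le> (norm u)\<^sup>2" using uv by (simp add: power_mult_distrib)
    then have "\<Lambda> * \<bar>v\<bar> \<le> norm u" by (rule power2_le_imp_le) simp
    then have "\<Lambda> \<le> norm s" using v by (simp add: ns pos_le_divide_eq)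
    then have \<tau>: "\<tau> \<le> 1" "0 \<le> \<tau>" using spos radius by (auto simp: \<tau>_def)
    have gs: "g \<bullet> s = \<alpha> - \<theta>" using v by (simp add: s stationary_v)
    have "s \<bullet> (H *v s) = (u \<bullet> (H *v u)) / v\<^sup>2"
      by (simp add: s matrix_vector_mult_scaleR power2_eq_square)
    also have "\<dots> = - \<theta> * (norm s)\<^sup>2 + (\<theta> - \<alpha>)"
      using v by (simp add: curvature_u ns power_divide add_divide_distrib diff_divide_distrib)
    finally have sHs: "s \<bullet> (H *v s) = - \<theta> * (norm s)\<^sup>2 + (\<theta> - \<alpha>)" .
    have "\<tau> * (g \<bullet> s) + \<tau>\<^sup>2 / 2 * (s \<bullet> (H *v s))
        = - ((\<theta> - \<alpha>) * (\<tau> * (1 - \<tau> / 2))) + - \<theta> * (\<tau> * norm s)\<^sup>2 / 2"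
      unfolding gs sHs by (simp add: power2_eq_square field_simps)
    moreover have "0 \<le> (\<theta> - \<alpha>) * (\<tau> * (1 - \<tau> / 2))" using alpha \<tau> by simp
    ultimately have "\<tau> * (g \<bullet> s) + \<tau>\<^sup>2 / 2 * (s \<bullet> (H *v s)) \<le> - \<theta> * (\<tau> * norm s)\<^sup>2 / 2"
      by linarith
    then show ?thesis using spos \<tau> by blast
  next
    case False
    then have s: "s = sgn1 (- (g \<bullet> u)) *\<^sub>R u" using direction by simp
    have sg: "(sgn1 a)\<^sup>2 = 1" "\<bar>sgn1 a\<bar> = 1" "sgn1 a * a = \<bar>a\<bar>" for a
      by (auto simp: sgn1_def)
    have ns: "norm s = norm u" by (simp add: s sg)
    then have spos: "0 < norm s" using \<open>u \<noteq> 0\<close> by simp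
    \<comment> \<open>A small v makes u long: its squared norm is at least 3/4, above the bound 1/2
      on \<Lambda>^2.\<close>
    have "\<bar>v\<bar>\<^sup>2 \<le> (1 / 2)\<^sup>2" using False threshold by (intro power_mono) auto
    then have "3 / 4 \<le> (norm u)\<^sup>2" using unit by (simp add: power_divide)
    then have "\<Lambda>\<^sup>2 \<le> (norm s)\<^sup>2" unfolding ns using radius(2) by linarith
    then have "\<Lambda> \<le> norm s" by (rule power2_le_imp_le) simp
    then have \<tau>: "\<tau> \<le> 1" "0 \<le> \<tau>" using spos radius by (auto simp: \<tau>_def)
    have "g \<bullet> s = - \<bar>g \<bullet> u\<bar>" using sg(3)[of "- (g \<bullet> u)"] by (simp add: s)
    then have gs: "g \<bullet> s = - ((\<theta> - \<alpha>) * \<bar>v\<bar>)" using alpha by (simp add: stationary_v abs_mult)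
    have "s \<bullet> (H *v s) = (sgn1 (- (g \<bullet> u)))\<^sup>2 * (u \<bullet> (H *v u))"
      by (simp add: s matrix_vector_mult_scaleR power2_eq_square)
    also have "\<dots> = - \<theta> * (norm s)\<^sup>2 + (\<theta> - \<alpha>) * \<bar>v\<bar>\<^sup>2"
      by (simp add: sg curvature_u ns)
    finally have sHs: "s \<bullet> (H *v s) = - \<theta> * (norm s)\<^sup>2 + (\<theta> - \<alpha>) * \<bar>v\<bar>\<^sup>2" .
    have "\<tau> * (g \<bullet> s) + \<tau>\<^sup>2 / 2 * (s \<bullet> (H *v s))
        = - ((\<theta> - \<alpha>) * (\<tau> * \<bar>v\<bar> * (1 - \<tau> * \<bar>v\<bar> / 2))) + - \<theta> * (\<tau> * norm s)\<^sup>2 / 2"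
      unfolding gs sHs by (simp add: power2_eq_square field_simps)
    moreover have "\<tau> * \<bar>v\<bar> \<le> 1 * 1"
      using \<tau> False threshold by (intro mult_mono) auto
    then have "0 \<le> (\<theta> - \<alpha>) * (\<tau> * \<bar>v\<bar> * (1 - \<tau> * \<bar>v\<bar> / 2))"
      using alpha \<tau> by (intro mult_nonneg_nonneg) auto
    ultimately have "\<tau> * (g \<bullet> s) + \<tau>\<^sup>2 / 2 * (s \<bullet> (H *v s)) \<le> - \<theta> * (\<tau> * norm s)\<^sup>2 / 2"
      by linarith
    then show ?thesis using spos \<tau> by blast
  qed
  then have \<tau>\<Lambda>: "\<tau> * norm s = \<Lambda>" by (simp add: \<tau>_def)
  show "norm d = \<Lambda>" using \<tau>s radius by (simp add: d_def)
  have "g \<bullet> d + (d \<bullet> (H *v d)) / 2 = \<tau> * (g \<bullet> s) + \<tau>\<^sup>2 / 2 * (s \<bullet> (H *v s))"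
    by (simp add: d_def \<tau>_def matrix_vector_mult_scaleR power2_eq_square)
  also have "\<dots> \<le> - \<theta> * \<Lambda>\<^sup>2 / 2" using \<tau>s \<tau>\<Lambda> by simp
  also have "\<dots> \<le> - \<alpha> * \<Lambda>\<^sup>2 / 2"
    using alpha by (intro divide_right_mono mult_right_mono) auto
  finally show "g \<bullet> d + (d \<bullet> (H *v d)) / 2 \<le> - \<alpha> * \<Lambda>\<^sup>2 / 2" .
qed

text \<open>Dividing the eigenvector equations by v gives the residual identity and
  \<open>g \<bullet> s = \<alpha> - \<theta>\<close>. The second bounds \<theta> in terms of norm g,
  the first bounds norm g in terms of \<theta>.\<close>

lemma final_step:
  assumes "\<bar>v\<bar> > sqrt (1 / (1 + \<Lambda>\<^sup>2))" and H: "\<And>w. norm (H *v w) \<le> L1 * norm w"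
  shows "norm s \<le> \<Lambda>" and "H *v s + g = - \<theta> *\<^sub>R s"
    and "\<theta> \<le> 2 * \<alpha> + sqrt 2 * L1 * \<Lambda>"
proof -
  have uv: "(norm u)\<^sup>2 \<le> \<Lambda>\<^sup>2 * v\<^sup>2" using assms(1) stop_iff by simp
  have "\<Lambda>\<^sup>2 * v\<^sup>2 \<le> 1 / 2 * v\<^sup>2" using radius by (intro mult_right_mono) auto
  then have "v\<^sup>2 \<ge> 1 / 2" using uv unit by simp
  \<comment> \<open>Since v^2 is at least 1/2 and \<omega>^2 at most 1/4, the definition of s is in
    its branch u / v.\<close>
  have "\<omega>\<^sup>2 \<le> (1 / 2)\<^sup>2" using threshold by (intro power_mono) auto
  then have "\<omega>\<^sup>2 \<le> \<bar>v\<bar>\<^sup>2" using \<open>v\<^sup>2 \<ge> 1 / 2\<close> by (simp add: power_divide)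
  then have "\<omega> \<le> \<bar>v\<bar>" by (rule power2_le_imp_le) simp
  then have s: "s = (1 / v) *\<^sub>R u" using direction by (simp add: divide_inverse)
  have v: "v \<noteq> 0" using \<open>\<omega> \<le> \<bar>v\<bar>\<close> threshold by auto
  have "(norm u)\<^sup>2 \<le> (\<Lambda> * \<bar>v\<bar>)\<^sup>2" using uv by (simp add: power_mult_distrib)
  then have "norm u \<le> \<Lambda> * \<bar>v\<bar>" using radius by (auto intro: power2_le_imp_le)
  then show s\<Lambda>: "norm s \<le> \<Lambda>" using v by (simp add: s pos_divide_le_eq)
  have "(1 / v) *\<^sub>R (H *v u + v *\<^sub>R g) = (1 / v) *\<^sub>R (- \<theta> *\<^sub>R u)" by (simp only: stationary_u)
  then show Hs: "H *v s + g = - \<theta> *\<^sub>R s"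
    using v by (simp add: s matrix_vector_mult_scaleR scaleR_add_right)
  have gs: "g \<bullet> s = \<alpha> - \<theta>" using v by (simp add: s stationary_v)
  have "- (g \<bullet> s) \<le> norm g * norm s" using norm_cauchy_schwarz[of "- g" s] by simp
  also have "\<dots> \<le> norm g * \<Lambda>" using s\<Lambda> by (rule mult_left_mono) simp
  finally have \<theta>: "\<theta> \<le> \<alpha> + norm g * \<Lambda>" using gs by simp
  (* \<theta> and norm g bound each other; the term norm g * \<Lambda>^2 is absorbed because \<Lambda>^2 \<le> 1/2. *)
  have "0 \<le> L1 * norm (axis undefined 1 :: real^'n)"
    by (rule order_trans[OF norm_ge_zero H])
  then have "0 \<le> L1" by (simp add: norm_axis_1)
  have "g = - \<theta> *\<^sub>R s - H *v s" using Hs by (simp add: eq_diff_eq add.commute)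
  then have "norm g \<le> norm (- \<theta> *\<^sub>R s) + norm (H *v s)" by (metis norm_triangle_ineq4)
  also have "\<dots> \<le> \<theta> * norm s + L1 * norm s" using H[of s] alpha by simp
  also have "\<dots> = (\<theta> + L1) * norm s" by (simp add: distrib_right)
  also have "\<dots> \<le> (\<alpha> + norm g * \<Lambda> + L1) * \<Lambda>"
    using \<theta> s\<Lambda> alpha \<open>0 \<le> L1\<close> radius by (intro mult_mono) auto
  finally have "norm g \<le> (\<alpha> + L1) * \<Lambda> + norm g * \<Lambda>\<^sup>2"
    by (simp add: power2_eq_square algebra_simps)
  moreover have "norm g * \<Lambda>\<^sup>2 \<le> norm g * (1 / 2)" using radius by (intro mult_left_mono) auto
  ultimately have "norm g \<le> 2 * ((\<alpha> + L1) * \<Lambda>)" by linarith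
  then have "norm g * \<Lambda> \<le> 2 * ((\<alpha> + L1) * \<Lambda>) * \<Lambda>" using radius by (intro mult_right_mono) auto
  then have "\<theta> \<le> \<alpha> + \<alpha> * (2 * \<Lambda>\<^sup>2) + L1 * (2 * \<Lambda>\<^sup>2)"
    using \<theta> by (simp add: power2_eq_square algebra_simps)
  also have "\<alpha> * (2 * \<Lambda>\<^sup>2) \<le> \<alpha> * 1" using radius alpha by (intro mult_left_mono) auto
  \<comment> \<open>As sqrt 2 \<Lambda> is at most 1, it dominates its own square; this is where the
    sqrt 2 of the final constants comes from.\<close>
  also have "2 * \<Lambda>\<^sup>2 \<le> sqrt 2 * \<Lambda>"
  proof -
    have "(sqrt 2 * \<Lambda>)\<^sup>2 \<le> 1\<^sup>2" using radius by (simp add: power_mult_distrib)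
    then have "sqrt 2 * \<Lambda> \<le> 1" by (rule power2_le_imp_le) simp
    then have "(sqrt 2 * \<Lambda>)\<^sup>2 \<le> sqrt 2 * \<Lambda>"
      using radius by (simp add: power2_eq_square[of "sqrt 2 * \<Lambda>"] mult_left_le)
    then show ?thesis by (simp add: power_mult_distrib)
  qed
  then have "L1 * (2 * \<Lambda>\<^sup>2) \<le> L1 * (sqrt 2 * \<Lambda>)" using \<open>0 \<le> L1\<close> by (rule mult_left_mono)
  finally show "\<theta> \<le> 2 * \<alpha> + sqrt 2 * L1 * \<Lambda>" by (simp add: mult_ac)
qed

end

text \<open>C stands for L2, the Lipschitz constant of the Hessian M of F. With \<epsilon> = C
  \<Lambda>^2 the two error bounds are \<epsilon>1 and \<epsilon>2.\<close>

locale inexact_hsda_step = hsda_step H g u s v \<theta> \<alpha> \<omega> \<Lambda>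
  for H :: "real^'n^'n" and g u s :: "real^'n" and v \<theta> \<alpha> \<omega> \<Lambda> :: real +
  fixes F :: "real^'n \<Rightarrow> real" and G :: "real^'n \<Rightarrow> real^'n" and M :: "real^'n \<Rightarrow> real^'n^'n"
    and C :: real and p :: "real^'n"
  assumes F: "\<And>z. GDERIV F z :> G z"
    and G: "\<And>z. (G has_derivative (\<lambda>h. M z *v h)) (at z)"
    and M: "\<And>p z w. norm (M p *v w - M z *v w) \<le> C * norm (p - z) * norm w"
    and alpha_eq: "\<alpha> = C * \<Lambda>"
    and gradient_error: "norm (G p - g) \<le> C * \<Lambda>\<^sup>2 / 12"
    and hessian_error: "\<And>w. norm (M p *v w - H *v w) \<le> C * \<Lambda> / 12 * norm w"
begin

section \<open>Decrease before the stop and accuracy at the stop\<close>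

lemma C_pos: "0 < C"
  using alpha radius unfolding alpha_eq by (simp add: zero_less_mult_iff)

text \<open>In units of C \<Lambda>^3 the model gains 1/2, while the gradient error costs 1/12, the
  Hessian error 1/24 and the Taylor remainder 1/6; this leaves 5/24.\<close>

lemma value_decrease:
  assumes "\<not> \<bar>v\<bar> > sqrt (1 / (1 + \<Lambda>\<^sup>2))"
  shows "F (p + (\<Lambda> / norm s) *\<^sub>R s) \<le> F p - 5 / 24 * C * \<Lambda> ^ 3"
proof -
  define d where "d = (\<Lambda> / norm s) *\<^sub>R s"
  note d = model_decrease[OF assms, folded d_def]
  have "G p \<bullet> d - g \<bullet> d \<le> norm (G p - g) * norm d"
    using norm_cauchy_schwarz[of "G p - g" d] by (simp add: inner_diff_left)
  also have "\<dots> \<le> C * \<Lambda>\<^sup>2 / 12 * \<Lambda>"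
    unfolding d(1) using gradient_error radius by (intro mult_right_mono) auto
  finally have 1: "G p \<bullet> d \<le> g \<bullet> d + C * \<Lambda> ^ 3 / 12"
    by (simp add: power2_eq_square power3_eq_cube mult_ac)
  have "d \<bullet> (M p *v d) - d \<bullet> (H *v d) \<le> norm d * norm (M p *v d - H *v d)"
    using norm_cauchy_schwarz[of d "M p *v d - H *v d"] by (simp add: inner_diff_right)
  also have "\<dots> \<le> norm d * (C * \<Lambda> / 12 * norm d)"
    by (intro mult_left_mono hessian_error) simp
  finally have 2: "d \<bullet> (M p *v d) \<le> d \<bullet> (H *v d) + C * \<Lambda> ^ 3 / 12"
    unfolding d(1) by (simp add: power2_eq_square power3_eq_cube mult_ac)
  have 3: "g \<bullet> d + (d \<bullet> (H *v d)) / 2 \<le> - (C * \<Lambda> ^ 3) / 2"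
    using d(2) unfolding alpha_eq by (simp add: power2_eq_square power3_eq_cube mult_ac)
  have "F (p + d) \<le> F p + G p \<bullet> d + (d \<bullet> (M p *v d)) / 2 + C / 6 * norm d ^ 3"
    by (rule taylor_value[OF F G M])
  then show ?thesis using 1 2 3 unfolding d(1) d_def[symmetric] by simp
qed

text \<open>In units of C \<Lambda>^2 the Taylor remainder contributes 1/2, the gradient and Hessian
  errors 1/12 each, and the residual \<theta> norm s contributes 2 besides its L1 term. The sum is
  16/6.\<close>

lemma final_gradient:
  assumes stop: "\<bar>v\<bar> > sqrt (1 / (1 + \<Lambda>\<^sup>2))" and H: "\<And>w. norm (H *v w) \<le> L1 * norm w"
  shows "norm (G (p + s)) \<le> sqrt 2 * L1 * \<Lambda>\<^sup>2 + 17 / 6 * C * \<Lambda>\<^sup>2"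
proof -
  note fs = final_step[OF assms]
  have "G (p + s) = (G (p + s) - G p - M p *v s) + ((G p - g) + ((M p *v s - H *v s) + (H *v s + g)))"
    by simp
  also have "norm \<dots> \<le> norm (G (p + s) - G p - M p *v s) + (norm (G p - g)
      + (norm (M p *v s - H *v s) + norm (H *v s + g)))"
    by (intro order_trans[OF norm_triangle_ineq] add_left_mono order_refl)
  also have "\<dots> \<le> C / 2 * \<Lambda>\<^sup>2 + (C * \<Lambda>\<^sup>2 / 12 + (C * \<Lambda> / 12 * \<Lambda> + (2 * \<alpha> + sqrt 2 * L1 * \<Lambda>) * \<Lambda>))"
  proof (intro add_mono gradient_error)
    have "norm (G (p + s) - G p - M p *v s) \<le> C / 2 * (norm s)\<^sup>2" by (rule taylor_gradient[OF G M])
    also have "\<dots> \<le> C / 2 * \<Lambda>\<^sup>2" using fs(1) C_pos by (intro mult_left_mono power_mono) auto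
    finally show "norm (G (p + s) - G p - M p *v s) \<le> C / 2 * \<Lambda>\<^sup>2" .
    have "norm (M p *v s - H *v s) \<le> C * \<Lambda> / 12 * norm s" by (rule hessian_error)
    also have "\<dots> \<le> C * \<Lambda> / 12 * \<Lambda>" using fs(1) C_pos radius by (intro mult_left_mono) auto
    finally show "norm (M p *v s - H *v s) \<le> C * \<Lambda> / 12 * \<Lambda>" .
    have "norm (H *v s + g) = \<theta> * norm s" using fs(2) alpha by simp
    also have "\<dots> \<le> (2 * \<alpha> + sqrt 2 * L1 * \<Lambda>) * \<Lambda>"
      using fs(1,3) alpha by (intro mult_mono) auto
    finally show "norm (H *v s + g) \<le> (2 * \<alpha> + sqrt 2 * L1 * \<Lambda>) * \<Lambda>" .
  qed
  also have "\<dots> = sqrt 2 * L1 * \<Lambda>\<^sup>2 + 16 / 6 * C * \<Lambda>\<^sup>2"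
    unfolding alpha_eq by (simp add: power2_eq_square field_simps)
  also have "\<dots> \<le> sqrt 2 * L1 * \<Lambda>\<^sup>2 + 17 / 6 * C * \<Lambda>\<^sup>2"
    using C_pos by (intro add_left_mono mult_right_mono) auto
  finally show ?thesis .
qed

text \<open>In units of C \<Lambda> the change of M over the step costs 1, the Hessian error 1/12,
  and \<theta> costs 2 besides its L1 term; 37/12 is below 19/6.\<close>

lemma final_hessian:
  assumes stop: "\<bar>v\<bar> > sqrt (1 / (1 + \<Lambda>\<^sup>2))" and H: "\<And>w. norm (H *v w) \<le> L1 * norm w"
    and curv: "\<And>w. w \<bullet> (H *v w) \<ge> - \<theta> * (norm w)\<^sup>2"
  shows "w \<bullet> (M (p + s) *v w) \<ge> - (sqrt 2 * L1 * \<Lambda> + 19 / 6 * C * \<Lambda>) * (norm w)\<^sup>2"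
proof -
  note fs = final_step[OF stop H]
  have "- (w \<bullet> (M (p + s) *v w - M p *v w)) \<le> norm w * norm (M (p + s) *v w - M p *v w)"
    using norm_cauchy_schwarz[of "- w"] by simp
  also have "\<dots> \<le> norm w * (C * norm (p + s - p) * norm w)" by (intro mult_left_mono M) simp
  also have "\<dots> \<le> norm w * (C * \<Lambda> * norm w)"
    using fs(1) C_pos by (intro mult_left_mono mult_right_mono) auto
  finally have 1: "w \<bullet> (M (p + s) *v w) \<ge> w \<bullet> (M p *v w) - C * \<Lambda> * (norm w)\<^sup>2"
    by (simp add: inner_diff_right power2_eq_square algebra_simps)
  have "- (w \<bullet> (M p *v w - H *v w)) \<le> norm w * norm (M p *v w - H *v w)"
    using norm_cauchy_schwarz[of "- w"] by simp
  also have "\<dots> \<le> norm w * (C * \<Lambda> / 12 * norm w)" by (intro mult_left_mono hessian_error) simp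
  finally have 2: "w \<bullet> (M p *v w) \<ge> w \<bullet> (H *v w) - C * \<Lambda> * (norm w)\<^sup>2 / 12"
    by (simp add: inner_diff_right power2_eq_square algebra_simps)
  have "(\<theta> + 13 / 12 * C * \<Lambda>) * (norm w)\<^sup>2 \<le> (sqrt 2 * L1 * \<Lambda> + 19 / 6 * C * \<Lambda>) * (norm w)\<^sup>2"
  proof (rule mult_right_mono)
    have "0 < C * \<Lambda>" using C_pos radius by simp
    then show "\<theta> + 13 / 12 * C * \<Lambda> \<le> sqrt 2 * L1 * \<Lambda> + 19 / 6 * C * \<Lambda>"
      using fs(3) unfolding alpha_eq by simp
  qed simp
  moreover have "(\<theta> + 13 / 12 * C * \<Lambda>) * (norm w)\<^sup>2 = \<theta> * (norm w)\<^sup>2 + 13 / 12 * (C * \<Lambda> * (norm w)\<^sup>2)"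
    by (simp add: distrib_right)
  ultimately show ?thesis using 1 2 curv[of w] unfolding mult_minus_left by linarith
qed

end

section \<open>The iteration bound\<close>

lemma reached_Suc: "1 \<le> t \<Longrightarrow> reached \<Lambda> v (Suc t) \<longleftrightarrow> reached \<Lambda> v t \<and> \<not> stops \<Lambda> v t"
  by (auto simp: reached_def less_Suc_eq)

text \<open>The existence conjunct gives the number T' its meaning, because \<open>LEAST\<close>
  over an empty set is unspecified.\<close>

theorem theorem2p1:
  fixes f :: "(real^'n) \<times> (real^'m) \<Rightarrow> real"
    and \<mu> l1 l2 F_inf \<kappa> L1 LH L2 \<epsilon> \<epsilon>1 \<epsilon>2 \<alpha> \<Lambda> \<omega> A c1 c2 :: real
    and N :: "nat \<Rightarrow> nat"
    and x u s :: "nat \<Rightarrow> real^'n" and y :: "nat \<Rightarrow> real^'m" and v :: "nat \<Rightarrow> real"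
    and T T' :: nat
  assumes "twice_differentiable f"
    and "\<mu> > 0" and "\<And>x. strongly_concave \<mu> (\<lambda>y. f (x, y))"
    and "l1-lipschitz_on UNIV (gradient f)"
    and "op_lipschitz l2 (hess_xx f)" and "op_lipschitz l2 (hess_xy f)"
    and "op_lipschitz l2 (hess_yx f)" and "op_lipschitz l2 (hess_yy f)"
    and "\<And>x. F_inf \<le> max_value f x"
    and "\<kappa> = l1 / \<mu>" and "L1 = (\<kappa> + 1) * l1"
    and "LH = l2 * (1 + \<kappa>)^2" and "L2 = l2 * (1 + \<kappa>)^3"
    and "0 < \<epsilon>" and "\<epsilon> \<le> min (L2 / 2) 1"
    and "\<alpha> = sqrt (L2 * \<epsilon>)" and "\<epsilon>1 = \<epsilon> / 12" and "\<epsilon>2 = sqrt (L2 * \<epsilon>) / 12"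
    and "\<Lambda> = sqrt (\<epsilon> / L2)" and "0 < \<omega>" and "\<omega> < 1 / 2"
    and "hsda_run f l1 \<kappa> \<omega> \<alpha> \<Lambda> N x y u v s"
    and "A = min (\<epsilon>1 / l1) (\<epsilon>2 / (2 * LH))" and "inner_counts f \<kappa> A \<Lambda> N x y v"
    and "c1 = sqrt 2 * L1 / L2 + 17 / 6"
    and "c2 = sqrt 2 * L1 / sqrt L2 + 13 / 6 * sqrt L2 + LH * (1 + \<kappa>) / sqrt L2"
    and "T' = (LEAST t. t \<ge> 1 \<and> \<bar>v t\<bar> > sqrt (1 / (1 + \<Lambda>\<^sup>2)))"
    and "T = (LEAST t. t \<ge> 1 \<and> norm (gradient (max_value f) (x (t + 1))) \<le> c1 * \<epsilon>
                 \<and> hessian (max_value f) (x (t + 1)) \<succeq> - (c2 * sqrt \<epsilon>) *\<^sub>R mat 1)"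
  shows "(\<exists>t\<ge>1. \<bar>v t\<bar> > sqrt (1 / (1 + \<Lambda>\<^sup>2)))
       \<and> norm (gradient (max_value f) (x (T' + 1))) \<le> c1 * \<epsilon>
       \<and> hessian (max_value f) (x (T' + 1)) \<succeq> - (c2 * sqrt \<epsilon>) *\<^sub>R mat 1
       \<and> T \<le> T'
       \<and> real T' \<le> 1 + 24 * sqrt L2 / 5 * (max_value f (x 1) - F_inf) * \<epsilon> powr (- (3 / 2))"
proof -
  interpret smooth_minimax f \<mu> l1 l2
    using assms(1-8) by unfold_locales auto
  note F_inf = \<open>\<And>x. F_inf \<le> max_value f x\<close>
  have \<kappa>: "\<kappa> = l1 / \<mu>" by fact
  have \<kappa>1: "1 \<le> \<kappa>" unfolding \<kappa> by (rule kappa_ge_1)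
  \<comment> \<open>The signs of L2, l2 and LH are not given; they follow from 0 < \<epsilon> \<le>
    L2 / 2.\<close>
  have L2_pos: "0 < L2" using \<open>0 < \<epsilon>\<close> \<open>\<epsilon> \<le> min (L2 / 2) 1\<close> by simp
  then have l2_pos: "0 < l2" using \<open>L2 = l2 * (1 + \<kappa>) ^ 3\<close> \<kappa>1 by (simp add: zero_less_mult_iff)
  have LH_pos: "0 < LH" unfolding \<open>LH = l2 * (1 + \<kappa>)\<^sup>2\<close> using l2_pos \<kappa>1 by simp
  have L2_LH: "LH * (1 + \<kappa>) = L2"
    by (simp add: \<open>LH = l2 * (1 + \<kappa>)\<^sup>2\<close> \<open>L2 = l2 * (1 + \<kappa>) ^ 3\<close> power2_eq_square power3_eq_cube)
  have \<Lambda>_pos: "0 < \<Lambda>" using \<open>0 < \<epsilon>\<close> L2_pos by (simp add: \<open>\<Lambda> = sqrt (\<epsilon> / L2)\<close>)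
  have \<Lambda>2: "\<Lambda>\<^sup>2 = \<epsilon> / L2" using \<open>0 < \<epsilon>\<close> L2_pos by (simp add: \<open>\<Lambda> = sqrt (\<epsilon> / L2)\<close>)
  have \<epsilon>: "\<epsilon> = L2 * \<Lambda>\<^sup>2" using L2_pos by (simp add: \<Lambda>2)
  have sqrt_\<epsilon>: "sqrt \<epsilon> = sqrt L2 * \<Lambda>"
    unfolding \<epsilon> using \<Lambda>_pos by (simp add: real_sqrt_mult)
  have \<Lambda>_half: "\<Lambda>\<^sup>2 \<le> 1 / 2"
    using \<open>\<epsilon> \<le> min (L2 / 2) 1\<close> L2_pos by (simp add: \<Lambda>2 field_simps)
  have \<alpha>: "\<alpha> = L2 * \<Lambda>"
    using L2_pos by (simp add: \<open>\<alpha> = sqrt (L2 * \<epsilon>)\<close> real_sqrt_mult sqrt_\<epsilon> flip: mult.assoc)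
  have \<epsilon>2: "\<epsilon>2 = L2 * \<Lambda> / 12"
    using \<alpha> by (simp add: \<open>\<epsilon>2 = sqrt (L2 * \<epsilon>) / 12\<close> \<open>\<alpha> = sqrt (L2 * \<epsilon>)\<close>)
  have A_pos: "0 < A"
    using l1_pos LH_pos \<open>0 < \<epsilon>\<close> \<Lambda>_pos L2_pos
    by (simp add: \<open>A = min (\<epsilon>1 / l1) (\<epsilon>2 / (2 * LH))\<close> \<open>\<epsilon>1 = \<epsilon> / 12\<close> \<epsilon>2)
  have "A \<le> \<epsilon>1 / l1" by (simp add: \<open>A = min (\<epsilon>1 / l1) (\<epsilon>2 / (2 * LH))\<close>)
  then have A1: "l1 * A \<le> L2 * \<Lambda>\<^sup>2 / 12"
    using l1_pos by (simp add: \<open>\<epsilon>1 = \<epsilon> / 12\<close> \<epsilon> field_simps)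
  have "A \<le> \<epsilon>2 / (2 * LH)" by (simp add: \<open>A = min (\<epsilon>1 / l1) (\<epsilon>2 / (2 * LH))\<close>)
  then have "2 * (LH * A) \<le> L2 * \<Lambda> / 12"
    using LH_pos by (simp add: \<epsilon>2 field_simps)
  moreover have "0 < LH * A" using LH_pos A_pos by simp
  ultimately have A2: "LH * A \<le> L2 * \<Lambda> / 12" by linarith

  let ?g = "\<lambda>t. grad_x f (x t, y t)" and ?H = "\<lambda>t. schur_H f (x t, y t)"
  have run: "y t = fst (accel_ascent (\<lambda>z. grad_y f (x t, z)) (1 / l1)
        ((sqrt \<kappa> - 1) / (sqrt \<kappa> + 1)) (y (t - 1)) (N t))"
    "is_arg_min (\<lambda>w. w \<bullet> bordered_mult (?H t) (?g t) \<alpha> w) (\<lambda>w. norm w \<le> 1) (u t, v t)"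
    "s t = (if \<bar>v t\<bar> \<ge> \<omega> then u t /\<^sub>R v t else sgn1 (- (?g t \<bullet> u t)) *\<^sub>R u t)"
    "x (t + 1) = (if stops \<Lambda> v t then x t + s t else x t + (\<Lambda> / norm (s t)) *\<^sub>R s t)"
    if "reached \<Lambda> v t" for t
    using \<open>hsda_run f l1 \<kappa> \<omega> \<alpha> \<Lambda> N x y u v s\<close> that unfolding hsda_run_def Let_def by blast+
  have counts: "2 * sqrt \<kappa> * ln (sqrt (\<kappa> + 1) * norm (y 0 - y_star f (x 1)) / A) \<le> real (N 1)"
    "\<And>t. 2 \<le> t \<Longrightarrow> reached \<Lambda> v t \<Longrightarrow>
      2 * sqrt \<kappa> * ln (sqrt (\<kappa> + 1) * (A + \<kappa> * norm (x t - x (t - 1))) / A) \<le> real (N t)"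
    using \<open>inner_counts f \<kappa> A \<Lambda> N x y v\<close> unfolding inner_counts_def by blast+

  have accuracy: "norm (y t - y_star f (x t)) \<le> A" if "1 \<le> t" "reached \<Lambda> v t" for t
    using that
  proof (induction t rule: dec_induct)
    case base
    show ?case
      using inner_loop_accuracy[folded \<kappa>, OF order_refl A_pos counts(1)] run(1)[OF base]
      by simp
  next
    case (step t)
    have "reached \<Lambda> v t" using step.prems step.hyps by (simp add: reached_Suc)
    then have "norm (y t - y_star f (x t)) \<le> A" by (rule step.IH)
    \<comment> \<open>Warm start: the previous inner result is A-close to the old maximizer, which
      moves by at most \<kappa> times the outer step. This sum is the distance allowed for in
      \<open>inner_counts\<close>.\<close>
    moreover have "norm (y_star f (x t) - y_star f (x (Suc t))) \<le> \<kappa> * norm (x (Suc t) - x t)"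
      using y_star_lipschitz[of "x t" "x (Suc t)"] by (simp add: \<kappa> norm_minus_commute)
    ultimately have r: "norm (y t - y_star f (x (Suc t))) \<le> A + \<kappa> * norm (x (Suc t) - x t)"
      using norm_triangle_ineq[of "y t - y_star f (x t)" "y_star f (x t) - y_star f (x (Suc t))"]
      by simp
    have "2 * sqrt \<kappa> * ln (sqrt (\<kappa> + 1) * (A + \<kappa> * norm (x (Suc t) - x t)) / A) \<le> real (N (Suc t))"
      using counts(2)[of "Suc t"] step.hyps step.prems by simp
    from inner_loop_accuracy[folded \<kappa>, OF r A_pos this] show ?case
      using run(1)[OF step.prems] by simp
  qed

  have inexact_step: "\<exists>\<theta>. inexact_hsda_step (?H t) (?g t) (u t) (s t) (v t) \<theta> \<alpha> \<omega> \<Lambda>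
      (max_value f) (gradient (max_value f)) (\<lambda>p. schur_H f (p, y_star f p)) L2 (x t)
      \<and> (\<forall>w. w \<bullet> (?H t *v w) \<ge> - \<theta> * (norm w)\<^sup>2)"
    if t: "1 \<le> t" "reached \<Lambda> v t" for t
  proof -
    have \<alpha>_pos: "0 < \<alpha>" using L2_pos \<Lambda>_pos by (simp add: \<alpha>)
    obtain \<theta> where \<theta>: "\<alpha> \<le> \<theta>" "(norm (u t))\<^sup>2 + (v t)\<^sup>2 = 1"
      "?H t *v u t + v t *\<^sub>R ?g t = - \<theta> *\<^sub>R u t" "?g t \<bullet> u t = (\<alpha> - \<theta>) * v t"
      "\<And>w. w \<bullet> (?H t *v w) \<ge> - \<theta> * (norm w)\<^sup>2"
      using bordered_minimizer[OF schur_H_symmetric \<alpha>_pos run(2)[OF t(2)]] by blast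
    let ?z = "(x t, y_star f (x t))"
    have zA: "norm (?z - (x t, y t)) \<le> A"
      using accuracy[OF t] by (simp add: norm_Pair norm_minus_commute)
    have g: "norm (gradient (max_value f) (x t) - ?g t) \<le> L2 * \<Lambda>\<^sup>2 / 12"
    proof -
      have "norm (gradient (max_value f) (x t) - ?g t) \<le> l1 * norm (?z - (x t, y t))"
        unfolding gradient_max_value by (rule grad_x_lipschitz)
      also have "\<dots> \<le> l1 * A" using zA l1_nonneg by (rule mult_left_mono)
      finally show ?thesis using A1 by simp
    qed
    have H: "norm (schur_H f ?z *v w - ?H t *v w) \<le> L2 * \<Lambda> / 12 * norm w" for w
    proof -
      have "norm (schur_H f ?z *v w - ?H t *v w) \<le> LH * norm (?z - (x t, y t)) * norm w"
        using schur_H_lipschitz by (simp only: \<open>LH = l2 * (1 + \<kappa>)\<^sup>2\<close> \<kappa>)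
      also have "\<dots> \<le> LH * A * norm w"
        using zA LH_pos by (intro mult_right_mono mult_left_mono) auto
      also have "\<dots> \<le> L2 * \<Lambda> / 12 * norm w" using A2 by (rule mult_right_mono) simp
      finally show ?thesis .
    qed
    have "inexact_hsda_step (?H t) (?g t) (u t) (s t) (v t) \<theta> \<alpha> \<omega> \<Lambda>
      (max_value f) (gradient (max_value f)) (\<lambda>p. schur_H f (p, y_star f p)) L2 (x t)"
    proof
      show "GDERIV (max_value f) z :> gradient (max_value f) z" for z
        using GDERIV_max_value by (simp add: gradient_max_value)
      show "norm (schur_H f (p, y_star f p) *v w - schur_H f (z, y_star f z) *v w)
          \<le> L2 * norm (p - z) * norm w" for p z w
        using schur_H_graph_lipschitz l2_pos by (simp add: \<open>L2 = l2 * (1 + \<kappa>) ^ 3\<close> \<kappa>)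
    qed (use \<alpha>_pos \<theta> \<Lambda>_pos \<Lambda>_half \<alpha> g H run(3)[OF t(2)] assms gradient_max_value_has_derivative in auto)
    then show ?thesis using \<theta>(5) by blast
  qed

  define \<delta> where "\<delta> = 5 / 24 * L2 * \<Lambda> ^ 3"
  have \<delta>_pos: "0 < \<delta>" using L2_pos \<Lambda>_pos by (simp add: \<delta>_def)
  \<comment> \<open>Arriving at x t takes t - 1 decreasing steps, hence the leading 1 in the
    iteration bound.\<close>
  have decrease: "max_value f (x t) \<le> max_value f (x 1) - (real t - 1) * \<delta>"
    if "1 \<le> t" "reached \<Lambda> v t" for t
    using that
  proof (induction t rule: dec_induct)
    case (step t)
    have t: "reached \<Lambda> v t" "\<not> stops \<Lambda> v t" using step.prems step.hyps by (auto simp: reached_Suc)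
    obtain \<theta> where "inexact_hsda_step (?H t) (?g t) (u t) (s t) (v t) \<theta> \<alpha> \<omega> \<Lambda>
      (max_value f) (gradient (max_value f)) (\<lambda>p. schur_H f (p, y_star f p)) L2 (x t)"
      using inexact_step[OF step.hyps(1) t(1)] by blast
    from inexact_hsda_step.value_decrease[OF this] t(2)
    have "max_value f (x (Suc t)) \<le> max_value f (x t) - \<delta>"
      using run(4)[OF t(1)] by (simp add: stops_def \<delta>_def)
    then show ?case using step.IH t(1) by (simp add: algebra_simps)
  qed simp
  have bound: "real t \<le> 1 + (max_value f (x 1) - F_inf) / \<delta>" if "1 \<le> t" "reached \<Lambda> v t" for t
  proof -
    have "(real t - 1) * \<delta> \<le> max_value f (x 1) - F_inf"
      using decrease[OF that] F_inf[of "x t"] by linarith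
    then have "real t - 1 \<le> (max_value f (x 1) - F_inf) / \<delta>"
      using \<delta>_pos by (simp add: pos_le_divide_eq)
    then show ?thesis by simp
  qed
  \<comment> \<open>Without a stop every iteration would be reached, and \<open>bound\<close> would
    cap all natural numbers.\<close>
  have ex: "\<exists>t\<ge>1. stops \<Lambda> v t"
  proof (rule ccontr)
    assume "\<not> (\<exists>t\<ge>1. stops \<Lambda> v t)"
    then have "real t \<le> 1 + (max_value f (x 1) - F_inf) / \<delta>" if "1 \<le> t" for t
      using bound[OF that] that by (auto simp: reached_def)
    moreover obtain n where "1 + (max_value f (x 1) - F_inf) / \<delta> < real n"
      using reals_Archimedean2 by blast
    ultimately show False by (smt (verit) of_nat_Suc le_add1 plus_1_eq_Suc)
  qed
  have T': "T' = (LEAST t. 1 \<le> t \<and> stops \<Lambda> v t)" using assms by (simp add: stops_def)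
  have T'_stop: "1 \<le> T'" "stops \<Lambda> v T'"
    using LeastI_ex[of "\<lambda>t. 1 \<le> t \<and> stops \<Lambda> v t"] ex unfolding T' by auto
  \<comment> \<open>Minimality of T' is exactly what makes the equations of the run available at
    T'.\<close>
  have T'_reached: "reached \<Lambda> v T'"
    using T'_stop not_less_Least[of _ "\<lambda>t. 1 \<le> t \<and> stops \<Lambda> v t"]
    unfolding reached_def T'[symmetric] by auto
  obtain \<theta> where \<theta>: "inexact_hsda_step (?H T') (?g T') (u T') (s T') (v T') \<theta> \<alpha> \<omega> \<Lambda>
      (max_value f) (gradient (max_value f)) (\<lambda>p. schur_H f (p, y_star f p)) L2 (x T')"
    "\<And>w. w \<bullet> (?H T' *v w) \<ge> - \<theta> * (norm w)\<^sup>2"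
    using inexact_step[OF T'_stop(1) T'_reached] by blast
  have stop: "\<bar>v T'\<bar> > sqrt (1 / (1 + \<Lambda>\<^sup>2))" using T'_stop(2) by (simp add: stops_def)
  have H_bound: "norm (?H T' *v w) \<le> L1 * norm w" for w
    using schur_H_bounded by (simp add: \<open>L1 = (\<kappa> + 1) * l1\<close> \<kappa>)
  have x_final: "x (T' + 1) = x T' + s T'" using run(4)[OF T'_reached] T'_stop(2) by simp
  have "norm (gradient (max_value f) (x (T' + 1))) \<le> sqrt 2 * L1 * \<Lambda>\<^sup>2 + 17 / 6 * L2 * \<Lambda>\<^sup>2"
    unfolding x_final by (rule inexact_hsda_step.final_gradient[OF \<theta>(1) stop H_bound])
  also have "\<dots> = c1 * \<epsilon>"
    using L2_pos by (simp add: \<open>c1 = sqrt 2 * L1 / L2 + 17 / 6\<close> \<epsilon> distrib_right)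
  finally have grad: "norm (gradient (max_value f) (x (T' + 1))) \<le> c1 * \<epsilon>" .
  \<comment> \<open>Because LH (1 + \<kappa>) = L2, the last term of c2 is another sqrt L2, and 13/6
    becomes 19/6.\<close>
  have c2: "c2 * sqrt \<epsilon> = sqrt 2 * L1 * \<Lambda> + 19 / 6 * L2 * \<Lambda>"
  proof -
    have "sqrt L2 * sqrt L2 = L2" using L2_pos by simp
    moreover have "c2 * sqrt \<epsilon> = sqrt 2 * L1 * \<Lambda> + 13 / 6 * (sqrt L2 * sqrt L2) * \<Lambda> + L2 * \<Lambda>"
      using L2_pos unfolding sqrt_\<epsilon> \<open>c2 = _\<close> L2_LH by (simp add: distrib_right)
    ultimately show ?thesis by simp
  qed
  have hess: "hessian (max_value f) (x (T' + 1)) \<succeq> - (c2 * sqrt \<epsilon>) *\<^sub>R mat 1"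
  proof -
    let ?M = "hessian (max_value f) (x (T' + 1))"
    have M: "?M = schur_H f (x (T' + 1), y_star f (x (T' + 1)))" by (rule hessian_max_value)
    have mult: "(?M - (- (c2 * sqrt \<epsilon>)) *\<^sub>R mat 1) *v w = ?M *v w + (c2 * sqrt \<epsilon>) *\<^sub>R w" for w
      by (simp add: matrix_vector_mult_add_rdistrib flip: scaleR_matrix_vector_assoc)
    \<comment> \<open>The Loewner order includes symmetry, so the bound on the quadratic form alone
      would not be enough.\<close>
    have "transpose ?M = ?M"
    proof -
      have "(transpose ?M *v a) \<bullet> b = (?M *v a) \<bullet> b" for a b
        unfolding M using schur_H_symmetric
        by (metis dot_lmul_matrix inner_commute transpose_matrix_vector)
      then show ?thesis by (metis matrix_eq vector_eq_rdot)
    qed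
    then have "transpose (?M - (- (c2 * sqrt \<epsilon>)) *\<^sub>R mat 1) = ?M - (- (c2 * sqrt \<epsilon>)) *\<^sub>R mat 1"
      by (auto simp: transpose_def vec_eq_iff mat_def)
    moreover have "0 \<le> w \<bullet> ((?M - (- (c2 * sqrt \<epsilon>)) *\<^sub>R mat 1) *v w)" for w
      using inexact_hsda_step.final_hessian[OF \<theta>(1) stop H_bound \<theta>(2), of w]
      unfolding mult unfolding M
      unfolding x_final c2 inner_add_right inner_scaleR_right power2_norm_eq_inner mult_minus_left
      by linarith
    ultimately show ?thesis by (simp add: loewner_ge_def positive_semidefinite_def)
  qed
  have "T \<le> T'"
    unfolding \<open>T = _\<close> by (rule Least_le) (use T'_stop grad hess in auto)
  moreover have "real T' \<le> 1 + 24 * sqrt L2 / 5 * (max_value f (x 1) - F_inf) * \<epsilon> powr (- (3 / 2))"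
  proof -
    \<comment> \<open>Written in \<Lambda>, this power identifies the constant of the theorem times
      \<epsilon>^(-3/2) as 1 / \<delta>.\<close>
    have "\<epsilon> powr (3 / 2) = \<epsilon> powr 1 * \<epsilon> powr (1 / 2)"
      using powr_add[of \<epsilon> 1 "1 / 2"] by simp
    also have "\<dots> = L2 * \<Lambda>\<^sup>2 * (sqrt L2 * \<Lambda>)"
      using \<open>0 < \<epsilon>\<close> by (simp add: powr_half_sqrt sqrt_\<epsilon> \<epsilon>[symmetric])
    finally have pw: "\<epsilon> powr (3 / 2) = L2 * \<Lambda>\<^sup>2 * (sqrt L2 * \<Lambda>)" .
    have "24 * sqrt L2 / 5 * \<epsilon> powr (- (3 / 2)) = 24 * sqrt L2 / 5 / (L2 * \<Lambda>\<^sup>2 * (sqrt L2 * \<Lambda>))"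
      unfolding powr_minus pw by (rule divide_inverse[symmetric])
    also have "\<dots> = 1 / \<delta>"
      using L2_pos \<Lambda>_pos by (simp add: \<delta>_def power2_eq_square power3_eq_cube)
    finally have inv_\<delta>: "24 * sqrt L2 / 5 * \<epsilon> powr (- (3 / 2)) = 1 / \<delta>" .
    have "(max_value f (x 1) - F_inf) / \<delta> = 1 / \<delta> * (max_value f (x 1) - F_inf)" by simp
    also have "\<dots> = 24 * sqrt L2 / 5 * (max_value f (x 1) - F_inf) * \<epsilon> powr (- (3 / 2))"
      unfolding inv_\<delta>[symmetric] by (simp only: mult_ac)
    finally have "(max_value f (x 1) - F_inf) / \<delta>
        = 24 * sqrt L2 / 5 * (max_value f (x 1) - F_inf) * \<epsilon> powr (- (3 / 2))" .
    then show ?thesis using bound[OF T'_stop(1) T'_reached] by (simp only:)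
  qed
  ultimately show ?thesis
    using ex grad hess by (auto simp: stops_def)
qed

end
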